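(* For every $A\subseteq\mathbb{Z}^+$, \[\mathrm{Dim}_\zeta(A)=2\cdot\dim_\gamma(F_A)=2\cdot\mathrm{Dim}_\gamma(F_A),\] where $F_A=\{f:\mathbb{N}\to\mathbb{N}\mid f(\mathbb{N})\subseteq A\text{ and }\lim_{n\to\infty}f(n)=\infty\}$.
   Context: For $A\subseteq\mathbb{Z}^+$, $\mathrm{Dim}_\zeta(A)=\inf\{s\ge0\mid\sum_{n\in A}n^{-s}<\infty\}$. $\mathbb{N}=\{0,1,2,\dots\}$. The Baire space $\mathbb{N}^\infty$ is the set of infinite sequences $z=z_0z_1z_2\cdots$ of natural numbers (identified with total functions $\mathbb{N}\to\mathbb{N}$), and $\mathbb{N}^*$ is the set of finite sequences; $\lambda$ is the empty sequence and $w\sqsubset z$ means $w$ is a prefix of $z$. For $w\in\mathbb{N}^*$, $C_w=\{z\in\mathbb{N}^\infty\mid w\sqsubset z\}$. Define $\mathrm{real}:\mathbb{N}^\infty\to[0,1]$ by the continued fraction $\mathrm{real}(z)=\cfrac{1}{(z_0+1)+\cfrac{1}{(z_1+1)+\cdots}}$. Gauss measure on $E\subseteq\mathbb{R}$ is $\gamma(E)=\frac{1}{\ln 2}\int_E\frac{dt}{1+t}$, and for $w\in\mathbb{N}^*$ write $\gamma(w)=\gamma(\mathrm{real}(C_w))$. Define a metric $\rho$ on $\mathbb{N}^\infty$ by $\rho(z,z')=\gamma(w)$ where $w$ is the longest common prefix of $z\ne z'$ (and $\rho(z,z)=0$). Then $\dim_\gamma$ and $\mathrm{Dim}_\gamma$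 denote, respectively, the Hausdorff dimension and the packing dimension of subsets of $\mathbb{N}^\infty$ with respect to the metric $\rho$. *)

theory Defs
  imports "HOL-Analysis.Analysis"
begin

section \<open>Zeta-dimension\<close>

definition zeta_dim :: "nat set \<Rightarrow> real" where
  "zeta_dim A = Inf {s. 0 \<le> s \<and> (\<lambda>n. real n powr (- s)) summable_on A}"

section \<open>Hausdorff and packing dimension in a metric space\<close>

context Metric_space
begin

text \<open>The counterpart of \<^const>\<open>diameter\<close>, which is only available for the type class
  of metric spaces. As there, it is only meaningful for bounded sets.\<close>

definition mdiameter :: "'a set \<Rightarrow> real" where
  "mdiameter U = (if U = {} then 0 else SUP (x, y)\<in>U \<times> U. d x y)"

text \<open>The power \<open>|U|\<^sup>s\<close> with the usual conventions that the empty set contributes \<open>0\<close> and that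
  \<open>0\<^sup>0 = 1\<close> for nonempty sets (whereas \<open>0 powr 0 = 0\<close> in the library).\<close>

definition diam_pow :: "real \<Rightarrow> 'a set \<Rightarrow> ennreal" where
  "diam_pow s U = (if U = {} then 0 else if s = 0 then 1 else ennreal (mdiameter U powr s))"

text \<open>The condition on pairs of points says that the diameter is at most \<open>\<delta>\<close>, without relying on
  the value of \<^term>\<open>mdiameter\<close> at unbounded sets.\<close>

definition delta_cover :: "real \<Rightarrow> 'a set \<Rightarrow> (nat \<Rightarrow> 'a set) \<Rightarrow> bool" where
  "delta_cover \<delta> E U \<longleftrightarrow> E \<subseteq> (\<Union>i. U i) \<and>
     (\<forall>i. U i \<subseteq> M \<and> (\<forall>x\<in>U i. \<forall>y\<in>U i. d x y \<le> \<delta>))"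

definition hausdorff_measure :: "real \<Rightarrow> 'a set \<Rightarrow> ennreal" where
  "hausdorff_measure s E =
     (SUP \<delta>\<in>{0<..}. INF U\<in>{U. delta_cover \<delta> E U}. \<Sum>i. diam_pow s (U i))"

definition hausdorff_dim :: "'a set \<Rightarrow> ereal" where
  "hausdorff_dim E = Inf {ereal s | s. 0 \<le> s \<and> hausdorff_measure s E = 0}"

text \<open>Packings are countable families of pairwise disjoint closed balls of radius at most \<open>\<delta>\<close> with
  centres in \<open>E\<close>. As in Tricot's and Falconer's definition, a ball \<open>B\<close> is weighted by its
  diameter, \<open>|B|\<^sup>s\<close>; in spaces such as the Baire space below, where the diameter of
  a ball may be much smaller than its radius, this is not the same as using \<open>(2 r)\<^sup>s\<close>.\<close>

definition delta_packing :: "real \<Rightarrow> 'a set \<Rightarrow> 'a set set \<Rightarrow> bool" where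
  "delta_packing \<delta> E \<B> \<longleftrightarrow> countable \<B> \<and> pairwise disjnt \<B> \<and>
     (\<forall>B\<in>\<B>. \<exists>x\<in>E. \<exists>r. 0 < r \<and> r \<le> \<delta> \<and> B = mcball x r)"

definition packing_premeasure :: "real \<Rightarrow> 'a set \<Rightarrow> ennreal" where
  "packing_premeasure s E =
     (INF \<delta>\<in>{0<..}. SUP \<B>\<in>{\<B>. delta_packing \<delta> E \<B>}. \<Sum>\<^sub>\<infinity>B\<in>\<B>. diam_pow s B)"

definition packing_measure :: "real \<Rightarrow> 'a set \<Rightarrow> ennreal" where
  "packing_measure s E =
     (INF F\<in>{F :: nat \<Rightarrow> 'a set. E \<subseteq> (\<Union>i. F i) \<and> (\<forall>i. F i \<subseteq> M)}. \<Sum>i. packing_premeasure s (F i))"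

definition packing_dim :: "'a set \<Rightarrow> ereal" where
  "packing_dim E = Inf {ereal s | s. 0 \<le> s \<and> packing_measure s E = 0}"

end

section \<open>The Baire space with the Gauss metric\<close>

text \<open>Points of the Baire space are functions \<open>nat \<Rightarrow> nat\<close>, finite sequences are lists.\<close>

definition cylinder :: "nat list \<Rightarrow> (nat \<Rightarrow> nat) set" where
  "cylinder w = {z. map z [0..<length w] = w}"

primrec cf_convergent :: "nat \<Rightarrow> (nat \<Rightarrow> nat) \<Rightarrow> real" where
  "cf_convergent 0 z = 0"
| "cf_convergent (Suc n) z = 1 / (real (z 0 + 1) + cf_convergent n (\<lambda>i. z (Suc i)))"

definition cf_real :: "(nat \<Rightarrow> nat) \<Rightarrow> real" where
  "cf_real z = lim (\<lambda>n. cf_convergent n z)"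

definition gauss_measure :: "real set \<Rightarrow> real" where
  "gauss_measure E = (1 / ln 2) * (LINT t:E|lebesgue. 1 / (1 + t))"

definition gauss_cyl :: "nat list \<Rightarrow> real" where
  "gauss_cyl w = gauss_measure (cf_real ` cylinder w)"

definition common_prefix :: "(nat \<Rightarrow> nat) \<Rightarrow> (nat \<Rightarrow> nat) \<Rightarrow> nat list" where
  "common_prefix z z' = map z [0..<(LEAST n. z n \<noteq> z' n)]"

definition gauss_dist :: "(nat \<Rightarrow> nat) \<Rightarrow> (nat \<Rightarrow> nat) \<Rightarrow> real" where
  "gauss_dist z z' = (if z = z' then 0 else gauss_cyl (common_prefix z z'))"

definition dim_gauss :: "(nat \<Rightarrow> nat) set \<Rightarrow> ereal" where
  "dim_gauss = Metric_space.hausdorff_dim UNIV gauss_dist"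

definition Dim_gauss :: "(nat \<Rightarrow> nat) set \<Rightarrow> ereal" where
  "Dim_gauss = Metric_space.packing_dim UNIV gauss_dist"

definition divergent_seqs :: "nat set \<Rightarrow> (nat \<Rightarrow> nat) set" where
  "divergent_seqs A = {f. range f \<subseteq> A \<and> filterlim f at_top sequentially}"

end

theory Submission
  imports Defs "HOL-Library.Sublist"
begin

text \<open>
  Appending a partial quotient \<open>n \<ge> 1\<close> to \<open>w\<close> multiplies \<open>\<gamma>(w)\<close> by a factor between
  \<open>n\<^sup>-\<^sup>2 / 48\<close> and \<open>4 n\<^sup>-\<^sup>2\<close>, because \<open>real(C\<^sub>w)\<close> is up to a countable set the image of
  the unit interval under a Moebius map of determinant \<open>\<plusminus>1\<close>. So the sums of \<open>\<gamma>(wn)\<^sup>s\<close> over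
  \<open>n \<in> A\<close> are governed by the zeta sum of \<open>A\<close> at \<open>2 s\<close>. Since sequences in \<open>F\<^sub>A\<close> tend to infinity,
  only tails of that sum matter. If \<open>2 s > Dim\<^sub>\<zeta>(A)\<close>, tails are small enough to absorb the constant,
  Kraft's inequality bounds every disjoint family of cylinders, and the packing measure of \<open>F\<^sub>A\<close>
  vanishes. If \<open>2 s < Dim\<^sub>\<zeta>(A)\<close>, every tail diverges, and any cover whose \<open>s\<close>-weight is too small is
  evaded by a branch chosen greedily. As \<open>\<rho>\<close> is an ultrametric, Hausdorff dimension is at most
  packing dimension by an elementary argument.
\<close>

section \<open>Gauss measure of continued fraction cylinders\<close>

abbreviation stem :: "(nat \<Rightarrow> nat) \<Rightarrow> nat \<Rightarrow> nat list" where
  "stem z n \<equiv> map z [0..<n]"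

text \<open>The finite continued fraction with partial quotients \<open>a + 1\<close> for the
  letters \<open>a\<close> of \<open>w\<close>, followed by an unspecified tail \<open>t\<close>;
  letting \<open>t\<close> run through the unit interval describes the whole cylinder at
  once.\<close>

primrec cf_map :: "nat list \<Rightarrow> real \<Rightarrow> real" where
  "cf_map [] t = t"
| "cf_map (a # w) t = 1 / (real (a + 1) + cf_map w t)"

lemma cf_map_append: "cf_map (v @ w) t = cf_map v (cf_map w t)"
  by (induction v) auto

lemma cf_map_bounds:
  assumes "0 \<le> t" "t \<le> 1"
  shows "0 \<le> cf_map w t" "cf_map w t \<le> 1"
proof -
  have "0 \<le> cf_map w t \<and> cf_map w t \<le> 1"
    by (induction w) (use assms in \<open>auto simp: divide_simps\<close>)
  then show "0 \<le> cf_map w t" "cf_map w t \<le> 1" by auto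
qed

lemma stem_Suc_shift: "stem z (Suc n) = z 0 # stem (\<lambda>i. z (Suc i)) n"
  by (simp add: map_upt_Suc del: upt_Suc)

lemma stem_add: "stem z (n + m) = stem z n @ stem (\<lambda>i. z (n + i)) m"
proof (induction m)
  case (Suc m)
  then show ?case by simp
qed simp

lemma cf_convergent_eq: "cf_convergent n z = cf_map (stem z n) 0"
  by (induction n arbitrary: z) (simp_all add: stem_Suc_shift del: upt_Suc)

text \<open>Classical recursion for convergents: \<open>p / q\<close> is the convergent of
  \<open>w\<close> and \<open>p' / q'\<close> the preceding one (formally \<open>1 / 0\<close> for
  the empty word), and each new letter multiplies by a matrix of determinant -1. The bound
  \<open>q' \<le> q\<close> later makes all denominators comparable to \<open>q\<close>.\<close>

lemma cf_map_moebius: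
  obtains p p' q q' :: real where "0 \<le> q'" "q' \<le> q" "0 < q" "\<bar>p' * q - p * q'\<bar> = 1"
    "\<And>t. 0 \<le> t \<Longrightarrow> cf_map w t = (p + t * p') / (q + t * q')"
proof -
  have "\<exists>p p' q q' :: real. 0 \<le> q' \<and> q' \<le> q \<and> 0 < q \<and> \<bar>p' * q - p * q'\<bar> = 1 \<and>
    (\<forall>t\<ge>0. cf_map w t = (p + t * p') / (q + t * q'))"
  proof (induction w rule: rev_induct)
    case Nil
    show ?case by (rule exI[of _ 0], rule exI[of _ 1], rule exI[of _ 1], rule exI[of _ 0]) simp
  next
    case (snoc a w)
    then obtain p p' q q' :: real where *: "0 \<le> q'" "q' \<le> q" "0 < q" "\<bar>p' * q - p * q'\<bar> = 1"
      "\<And>t. 0 \<le> t \<Longrightarrow> cf_map w t = (p + t * p') / (q + t * q')" by blast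
    define b where "b = real (a + 1)"
    have b: "b \<ge> 1" by (simp add: b_def)
    have map: "cf_map (w @ [a]) t = (p * b + p' + t * p) / (q * b + q' + t * q)" if "t \<ge> 0" for t
    proof -
      have "b + t > 0" using b that by auto
      have clear: "(x + 1 / (b + t) * y) * (b + t) = x * b + y + t * x" for x y
        using \<open>b + t > 0\<close> by (simp add: field_simps)
      have "cf_map (w @ [a]) t = (p + 1 / (b + t) * p') / (q + 1 / (b + t) * q')"
        using *(5)[of "1 / (b + t)"] b that by (simp add: cf_map_append b_def)
      also have "\<dots> = ((p + 1 / (b + t) * p') * (b + t)) / ((q + 1 / (b + t) * q') * (b + t))"
        using \<open>b + t > 0\<close> by simp
      also have "\<dots> = (p * b + p' + t * p) / (q * b + q' + t * q)"
        unfolding clear ..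
      finally show ?thesis .
    qed
    have qb: "q \<le> q * b + q'"
      using mult_left_mono[of 1 b q] *(1,3) b by linarith
    then have pos: "0 < q * b + q'" using *(3) by linarith
    have det: "\<bar>p * (q * b + q') - (p * b + p') * q\<bar> = 1"
      using *(4) by (simp add: algebra_simps abs_minus_commute)
    show ?case
      by (rule exI[of _ "p * b + p'"], rule exI[of _ p], rule exI[of _ "q * b + q'"], rule exI[of _ q])
         (intro conjI allI impI map less_imp_le[OF *(3)] qb pos det)
  qed
  then show thesis by (elim exE conjE) (rule that; simp)
qed

text \<open>Cross-multiplying the Moebius form leaves only the determinant as a factor of
  \<open>t - s\<close>; its sign \<open>\<sigma>\<close> gives the orientation of the map and the
  denominators its distortion.\<close>

lemma cf_map_diff:
  obtains q q' \<sigma> :: real where "0 \<le> q'" "q' \<le> q" "0 < q" "\<sigma> = 1 \<or> \<sigma> = - 1"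
    "\<And>s t. 0 \<le> s \<Longrightarrow> 0 \<le> t \<Longrightarrow>
      cf_map w t - cf_map w s = \<sigma> * (t - s) / ((q + t * q') * (q + s * q'))"
proof -
  obtain p p' q q' :: real where *: "0 \<le> q'" "q' \<le> q" "0 < q" "\<bar>p' * q - p * q'\<bar> = 1"
    "\<And>t. 0 \<le> t \<Longrightarrow> cf_map w t = (p + t * p') / (q + t * q')"
    by (rule cf_map_moebius[of w]) (rule that)
  define \<sigma> where "\<sigma> = p' * q - p * q'"
  show thesis
  proof (rule that[of q' q \<sigma>])
    fix s t :: real assume st: "0 \<le> s" "0 \<le> t"
    have pos: "q + t * q' > 0" "q + s * q' > 0" using *(1-3) st by (auto intro: add_pos_nonneg)
    have "cf_map w t - cf_map w s =
        ((p + t * p') * (q + s * q') - (p + s * p') * (q + t * q')) / ((q + t * q') * (q + s * q'))"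
      unfolding *(5)[OF st(1)] *(5)[OF st(2)] using pos by (intro diff_frac_eq) auto
    also have "(p + t * p') * (q + s * q') - (p + s * p') * (q + t * q') = \<sigma> * (t - s)"
      by (simp add: \<sigma>_def algebra_simps)
    finally show "cf_map w t - cf_map w s = \<sigma> * (t - s) / ((q + t * q') * (q + s * q'))" .
  qed (use *(1-4) in \<open>auto simp: \<sigma>_def abs_if split: if_splits\<close>)
qed

section \<open>Lengths of the intervals spanned by cylinders\<close>

definition cf_length :: "nat list \<Rightarrow> real" where
  "cf_length w = \<bar>cf_map w 1 - cf_map w 0\<bar>"

lemma cf_length_Nil [simp]: "cf_length [] = 1"
  by (simp add: cf_length_def)

text \<open>The difference formula evaluates both lengths exactly: \<open>1 / ((q + q') * q)\<close>
  before and \<open>1 / (((b + 1) * q + q') * (b * q + q'))\<close> after appending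
  \<open>a\<close>, where \<open>b = a + 1\<close>. All bounds then follow from
  \<open>0 \<le> q' \<le> q\<close>.\<close>

lemma cf_length_snoc:
  shows cf_length_snoc_half: "cf_length (w @ [a]) \<le> cf_length w / 2"
    and cf_length_snoc_le: "cf_length (w @ [a]) \<le> 2 / (real (a + 1) * real (a + 2)) * cf_length w"
    and cf_length_snoc_ge: "cf_length w / (4 * (real (a + 1) * real (a + 2))) \<le> cf_length (w @ [a])"
    and cf_length_pos: "cf_length w > 0"
proof -
  obtain q q' \<sigma> :: real where *: "0 \<le> q'" "q' \<le> q" "0 < q" "\<sigma> = 1 \<or> \<sigma> = - 1"
    "\<And>s t. 0 \<le> s \<Longrightarrow> 0 \<le> t \<Longrightarrow>
      cf_map w t - cf_map w s = \<sigma> * (t - s) / ((q + t * q') * (q + s * q'))"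
    by (rule cf_map_diff[of w]) (rule that)
  define b where "b = real (a + 1)"
  have b: "b \<ge> 1" by (simp add: b_def)
  have L: "cf_length w = 1 / ((q + q') * q)"
    using *(1-4) *(5)[of 0 1] by (auto simp: cf_length_def abs_mult)
  have bq: "b * q \<ge> q" using mult_right_mono[of 1 b q] b *(3) by linarith
  have pos: "b * q + q' > 0" "(b + 1) * q + q' > 0"
    unfolding distrib_right using bq *(1-3) by - linarith+
  \<comment> \<open>The appended letter sends the tails \<open>1\<close> and \<open>0\<close> to
    \<open>1 / (b + 1)\<close> and \<open>1 / b\<close>.\<close>
  have "cf_length (w @ [a]) =
      \<bar>\<sigma> * (1 / (b + 1) - 1 / b) / ((q + 1 / (b + 1) * q') * (q + 1 / b * q'))\<bar>"
    using *(5)[of "1 / b" "1 / (b + 1)"] b by (simp add: cf_length_def cf_map_append b_def add_ac)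
  also have "\<dots> = 1 / (((b + 1) * q + q') * (b * q + q'))"
  proof -
    have "(1 / (b + 1) - 1 / b) / ((q + 1 / (b + 1) * q') * (q + 1 / b * q')) =
       - 1 / (((b + 1) * q + q') * (b * q + q'))"
    proof -
      have e1: "q + 1 / (b + 1) * q' = ((b + 1) * q + q') / (b + 1)"
        and e2: "q + 1 / b * q' = (b * q + q') / b"
        and e3: "1 / (b + 1) - 1 / b = - 1 / ((b + 1) * b)"
        using b by (auto simp: field_simps)
      show ?thesis unfolding e1 e2 e3 using b pos by (simp add: divide_simps)
    qed
    then have "\<bar>\<sigma> * ((1 / (b + 1) - 1 / b) / ((q + 1 / (b + 1) * q') * (q + 1 / b * q')))\<bar> =
        1 / (((b + 1) * q + q') * (b * q + q'))"
      using *(4) pos by (auto simp: abs_mult simp del: divide_minus_left)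
    then show ?thesis unfolding times_divide_eq_right .
  qed
  finally have LS: "cf_length (w @ [a]) = 1 / (((b + 1) * q + q') * (b * q + q'))" .
  show "cf_length w > 0" unfolding L using *(1-3) by simp
  \<comment> \<open>\<open>X\<close> and \<open>Y\<close> lie within a factor 2 of
    \<open>(b + 1) * q\<close> and \<open>b * q\<close>; the bounds \<open>2 * q \<le> X\<close> and
    \<open>q + q' \<le> Y\<close> give the halving.\<close>
  define X Y where "X = (b + 1) * q + q'" and "Y = b * q + q'"
  have X: "2 * q \<le> X" "X \<le> 2 * ((b + 1) * q)" "(b + 1) * q \<le> X" "0 < X"
    and Y: "q + q' \<le> Y" "Y \<le> 2 * (b * q)" "b * q \<le> Y" "0 < Y"
    using bq *(1-3) unfolding X_def Y_def distrib_right distrib_left mult_1 by - linarith+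
  have Z: "cf_length (w @ [a]) = 1 / (X * Y)" "0 < b * (b + 1)" "0 < (q + q') * q" "0 < X * Y"
    using LS X Y b *(1-3) by (simp_all add: X_def Y_def add_pos_nonneg)
  have ab: "real (a + 1) * real (a + 2) = b * (b + 1)" by (simp add: b_def)
  have "(2 * q) * (q + q') \<le> X * Y"
    using X Y *(1-3) by (intro mult_mono) auto
  then show "cf_length (w @ [a]) \<le> cf_length w / 2"
    unfolding L Z(1) using Z(3,4) by (simp add: field_simps)
  have "(b * (b + 1)) * ((q + q') * q) \<le> (b * (b + 1)) * (2 * q * q)"
    using *(1-3) b by (intro mult_left_mono mult_right_mono) auto
  also have "\<dots> = 2 * (((b + 1) * q) * (b * q))" by (simp add: algebra_simps)
  also have "\<dots> \<le> 2 * (X * Y)"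
    using X Y *(1-3) b by (intro mult_left_mono mult_mono) auto
  finally have le: "(b * (b + 1)) * ((q + q') * q) \<le> 2 * (X * Y)" .
  have aux: "1 / C \<le> 2 / A * (1 / B)" if "A * B \<le> 2 * C" "0 < A" "0 < B" "0 < C" for A B C :: real
    using that by (simp add: field_simps)
  show "cf_length (w @ [a]) \<le> 2 / (real (a + 1) * real (a + 2)) * cf_length w"
    unfolding L Z(1) ab by (rule aux[OF le Z(2-4)])
  have "X * Y \<le> (2 * ((b + 1) * q)) * (2 * (b * q))"
    using X Y *(1-3) b by (intro mult_mono) auto
  also have "\<dots> = (4 * (b * (b + 1))) * (q * q)" by (simp add: algebra_simps)
  also have "\<dots> \<le> (4 * (b * (b + 1))) * ((q + q') * q)"
    using *(1-3) b by (intro mult_left_mono mult_right_mono) auto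
  finally have ge: "X * Y \<le> (4 * (b * (b + 1))) * ((q + q') * q)" .
  have aux2: "(1 / B) / A \<le> 1 / C" if "C \<le> A * B" "0 < A" "0 < B" "0 < C" for A B C :: real
    using that by (simp add: field_simps)
  show "cf_length w / (4 * (real (a + 1) * real (a + 2))) \<le> cf_length (w @ [a])"
    unfolding L Z(1) ab by (rule aux2[OF ge _ Z(3,4)]) (use Z(2) in simp)
qed

lemma cf_length_le_power: "cf_length w \<le> (1 / 2) ^ length w"
proof (induction w rule: rev_induct)
  case (snoc a w)
  then show ?case using cf_length_snoc_half[of w a] by simp
qed simp

text \<open>Up to the sign \<open>\<sigma>\<close> the map is increasing, and it is continuous, so
  it sends the interval onto the segment between its end values.\<close>

lemma cf_map_image: "cf_map w ` {0..1} = closed_segment (cf_map w 0) (cf_map w 1)"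
proof -
  obtain q q' \<sigma> :: real where *: "0 \<le> q'" "q' \<le> q" "0 < q" "\<sigma> = 1 \<or> \<sigma> = - 1"
    "\<And>s t. 0 \<le> s \<Longrightarrow> 0 \<le> t \<Longrightarrow>
      cf_map w t - cf_map w s = \<sigma> * (t - s) / ((q + t * q') * (q + s * q'))"
    by (rule cf_map_diff[of w]) (rule that)
  have pos: "q + t * q' > 0" if "t \<ge> 0" for t using *(1-3) that by (auto intro: add_pos_nonneg)
  have mono: "0 \<le> \<sigma> * (cf_map w t - cf_map w s)" if "0 \<le> s" "s \<le> t" for s t
  proof -
    have "\<sigma> * (cf_map w t - cf_map w s) = (\<sigma> * \<sigma>) * ((t - s) / ((q + t * q') * (q + s * q')))"
      using *(5)[of s t] that by simp
    also have "\<dots> \<ge> 0" using *(4) that pos[of s] pos[of t] by auto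
    finally show ?thesis .
  qed
  show ?thesis
  proof
    show "cf_map w ` {0..1} \<subseteq> closed_segment (cf_map w 0) (cf_map w 1)"
    proof safe
      fix t :: real assume t: "t \<in> {0..1}"
      show "cf_map w t \<in> closed_segment (cf_map w 0) (cf_map w 1)"
        using *(4) mono[of 0 t] mono[of t 1] t
        by (auto simp: closed_segment_eq_real_ivl)
    qed
    have "continuous_on {0..1} (cf_map w)"
    proof -
      have "continuous_on {0..1} (\<lambda>t. cf_map w 0 + \<sigma> * (t - 0) / ((q + t * q') * (q + 0 * q')))"
        using *(1-3) pos by (intro continuous_intros) (auto simp: less_imp_neq[symmetric])
      moreover have "cf_map w t = cf_map w 0 + \<sigma> * (t - 0) / ((q + t * q') * (q + 0 * q'))"
        if "t \<in> {0..1}" for t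
        using *(5)[of 0 t] that by simp
      ultimately show ?thesis by (metis (no_types, lifting) continuous_on_cong)
    qed
    then have "connected (cf_map w ` {0..1})"
      by (intro connected_continuous_image) auto
    then have "convex (cf_map w ` {0..1})"
      using is_interval_connected_1 is_interval_convex by blast
    then show "closed_segment (cf_map w 0) (cf_map w 1) \<subseteq> cf_map w ` {0..1}"
      by (intro closed_segment_subset) auto
  qed
qed

section \<open>Convergence and range of infinite continued fractions\<close>

lemma cf_map_close:
  assumes "0 \<le> s" "s \<le> 1" "0 \<le> t" "t \<le> 1"
  shows "\<bar>cf_map w s - cf_map w t\<bar> \<le> (1 / 2) ^ length w"
proof -
  have "cf_map w s \<in> closed_segment (cf_map w 0) (cf_map w 1)"
    "cf_map w t \<in> closed_segment (cf_map w 0) (cf_map w 1)"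
    using assms unfolding cf_map_image[symmetric] by auto
  then have "\<bar>cf_map w s - cf_map w t\<bar> \<le> cf_length w"
    by (auto simp: closed_segment_eq_real_ivl cf_length_def split: if_splits)
  then show ?thesis using cf_length_le_power[of w] by linarith
qed

text \<open>Both \<open>y\<close> and the \<open>n\<close>-th convergent are values of
  \<open>cf_map (stem z n)\<close> on the unit interval, hence at most \<open>(1 / 2) ^ n\<close>
  apart.\<close>

lemma cf_real_eqI:
  assumes "\<And>n. 0 \<le> x n" "\<And>n. x n \<le> 1" "\<And>n. y = cf_map (stem z n) (x n)"
  shows "cf_real z = y"
proof -
  have "(\<lambda>n. cf_convergent n z) \<longlonglongrightarrow> y"
  proof (rule LIM_zero_cancel, rule Lim_null_comparison)
    show "\<forall>\<^sub>F n in sequentially. norm (cf_convergent n z - y) \<le> (1 / 2) ^ n"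
    proof (rule always_eventually, rule allI)
      fix n
      show "norm (cf_convergent n z - y) \<le> (1 / 2) ^ n"
        unfolding cf_convergent_eq assms(3)[of n] real_norm_def
        using cf_map_close[of 0 "x n" "stem z n"] assms(1,2)[of n] by simp
    qed
  qed (simp add: LIMSEQ_realpow_zero)
  then show ?thesis unfolding cf_real_def by (rule limI)
qed

text \<open>Since \<open>cf_real\<close> is defined by \<open>lim\<close>, convergence has to be
  established before its value means anything. Convergents beyond index \<open>M\<close> differ from
  the \<open>M\<close>-th only in the tail put after the first \<open>M\<close> letters.\<close>

lemma cf_convergent_tendsto: "(\<lambda>n. cf_convergent n z) \<longlonglongrightarrow> cf_real z"
proof -
  have "Cauchy (\<lambda>n. cf_convergent n z)"
  proof (rule metric_CauchyI)
    fix e :: real assume "e > 0"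
    obtain M where M: "(1 / 2) ^ M < e / 2"
      using real_arch_pow_inv[of "e / 2" "1 / 2"] \<open>e > 0\<close> by auto
    have close: "dist (cf_convergent M z) (cf_convergent (M + k) z) \<le> (1 / 2) ^ M" for k
      using cf_map_close[of 0 "cf_map (stem (\<lambda>i. z (M + i)) k) 0" "stem z M"] cf_map_bounds
      by (simp add: cf_convergent_eq stem_add cf_map_append dist_real_def)
    have "dist (cf_convergent m z) (cf_convergent n z) < e" if "m \<ge> M" "n \<ge> M" for m n
      using close[of "m - M"] close[of "n - M"] that M
        dist_triangle2[of "cf_convergent m z" "cf_convergent n z" "cf_convergent M z"]
      by (simp add: dist_commute)
    then show "\<exists>M. \<forall>m\<ge>M. \<forall>n\<ge>M. dist (cf_convergent m z) (cf_convergent n z) < e" by blast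
  qed
  then show ?thesis
    unfolding cf_real_def by (simp add: convergent_LIMSEQ_iff[symmetric] Cauchy_convergent_iff)
qed

lemma cf_real_bounds: "0 \<le> cf_real z" "cf_real z \<le> 1"
proof -
  have "0 \<le> cf_convergent n z" "cf_convergent n z \<le> 1" for n
    unfolding cf_convergent_eq using cf_map_bounds[of 0] by auto
  then show "0 \<le> cf_real z" "cf_real z \<le> 1"
    using LIMSEQ_le_const[OF cf_convergent_tendsto] LIMSEQ_le_const2[OF cf_convergent_tendsto]
    by blast+
qed

lemma cf_real_Suc: "cf_real z = 1 / (real (z 0 + 1) + cf_real (\<lambda>i. z (Suc i)))"
proof (rule LIMSEQ_unique)
  show "(\<lambda>n. cf_convergent (Suc n) z) \<longlonglongrightarrow> cf_real z"
    by (rule LIMSEQ_Suc[OF cf_convergent_tendsto])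
  have "real (z 0 + 1) + cf_real (\<lambda>i. z (Suc i)) \<noteq> 0"
    using cf_real_bounds(1)[of "\<lambda>i. z (Suc i)"] by simp
  then show "(\<lambda>n. cf_convergent (Suc n) z) \<longlonglongrightarrow> 1 / (real (z 0 + 1) + cf_real (\<lambda>i. z (Suc i)))"
    unfolding cf_convergent.simps by (intro tendsto_intros cf_convergent_tendsto)
qed

lemma cf_real_stem: "cf_real z = cf_map (stem z n) (cf_real (\<lambda>i. z (n + i)))"
proof (induction n arbitrary: z)
  case (Suc n)
  show ?case
    by (subst cf_real_Suc, subst Suc) (simp add: stem_Suc_shift del: upt_Suc)
qed simp

text \<open>The digits are read off the orbit of \<open>x\<close> under the Gauss map
  \<open>y \<mapsto> frac (1 / y)\<close>. Irrationality keeps the orbit away from 0, so the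
  expansion never stops.\<close>

lemma irrational_in_range_cf_real:
  fixes x :: real
  assumes "0 < x" "x < 1" "x \<notin> \<rat>"
  shows "x \<in> range cf_real"
proof -
  define g where "g = (\<lambda>n. ((\<lambda>y::real. frac (1 / y)) ^^ n) x)"
  \<comment> \<open>A letter \<open>k\<close> encodes the partial quotient \<open>k + 1\<close>; the
    floor is at least 1, so the truncated subtraction is exact.\<close>
  define z where "z = (\<lambda>n. nat \<lfloor>1 / g n\<rfloor> - 1)"
  have g: "0 < g n \<and> g n < 1 \<and> g n \<notin> \<rat>" for n
  proof (induction n)
    case (Suc n)
    have "1 / g n \<notin> \<rat>" using Suc Rats_divide[of 1 "1 / g n"] by auto
    have "frac (1 / g n) \<notin> \<rat>"
    proof
      assume "frac (1 / g n) \<in> \<rat>"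
      then have "frac (1 / g n) + of_int \<lfloor>1 / g n\<rfloor> \<in> \<rat>" by (intro Rats_add) auto
      then show False using \<open>1 / g n \<notin> \<rat>\<close> by (simp add: frac_def)
    qed
    moreover have "frac (1 / g n) \<noteq> 0" using \<open>frac (1 / g n) \<notin> \<rat>\<close> by (metis Rats_0)
    moreover have "g (Suc n) = frac (1 / g n)" by (simp add: g_def)
    ultimately show ?case using frac_ge_0[of "1 / g n"] frac_lt_1[of "1 / g n"]
      by (simp add: less_le)
  qed (use assms in \<open>auto simp: g_def\<close>)
  have step: "g n = 1 / (real (z n + 1) + g (Suc n))" for n
  proof -
    have "1 / g n > 1" using g[of n] by simp
    then have "\<lfloor>1 / g n\<rfloor> \<ge> 1" by simp
    then have "int (z n + 1) = \<lfloor>1 / g n\<rfloor>" using g[of n] by (simp add: z_def less_imp_le)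
    then have "real (z n + 1) = of_int \<lfloor>1 / g n\<rfloor>" by (metis of_int_of_nat_eq)
    moreover have "g (Suc n) = 1 / g n - of_int \<lfloor>1 / g n\<rfloor>" by (simp add: g_def frac_def)
    ultimately show ?thesis by simp
  qed
  have "x = cf_map (stem z n) (g n)" for n
  proof (induction n)
    case (Suc n)
    then show ?case using step[of n] by (simp add: cf_map_append)
  qed (simp add: g_def)
  then have "cf_real z = x" using g by (intro cf_real_eqI[of g]) (auto intro: less_imp_le)
  then show ?thesis by blast
qed

section \<open>Gauss measure of cylinders\<close>

lemma cylinder_stem: "cylinder (stem z n) = {y. \<forall>i<n. y i = z i}"
  by (auto simp: cylinder_def list_eq_iff_nth_eq)

lemma cf_real_cylinder: "cf_real ` cylinder w = cf_map w ` range cf_real"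
proof
  show "cf_real ` cylinder w \<subseteq> cf_map w ` range cf_real"
  proof safe
    fix z assume "z \<in> cylinder w"
    then have "stem z (length w) = w" by (simp add: cylinder_def)
    then show "cf_real z \<in> cf_map w ` range cf_real"
      using cf_real_stem[of z "length w"] by auto
  qed
  show "cf_map w ` range cf_real \<subseteq> cf_real ` cylinder w"
  proof safe
    fix z
    \<comment> \<open>Prepending \<open>w\<close> to \<open>z\<close> gives the point of the
      cylinder with tail \<open>z\<close>.\<close>
    define y where "y = (\<lambda>i. if i < length w then w ! i else z (i - length w))"
    have "stem y (length w) = w" by (intro nth_equalityI) (simp_all add: y_def)
    moreover have "(\<lambda>i. y (length w + i)) = z" by (auto simp: y_def)
    ultimately have "y \<in> cylinder w" "cf_real y = cf_map w (cf_real z)"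
      using cf_real_stem[of y "length w"] by (auto simp: cylinder_def)
    then show "cf_map w (cf_real z) \<in> cf_real ` cylinder w" by (metis imageI)
  qed
qed

lemma gauss_measure_Icc:
  assumes "0 \<le> a" "a \<le> b"
  shows "gauss_measure {a..b} = (ln (1 + b) - ln (1 + a)) / ln 2"
proof -
  have "((\<lambda>t. 1 / (1 + t)) has_integral (ln (1 + b) - ln (1 + a))) {a..b}"
    using assms
    by (intro fundamental_theorem_of_calculus)
       (auto intro!: derivative_eq_intros simp: has_real_derivative_iff_has_vector_derivative[symmetric])
  moreover have "set_integrable lebesgue {a..b} (\<lambda>t. 1 / (1 + t))"
    using assms by (intro absolutely_integrable_continuous_real continuous_intros) auto
  ultimately show ?thesis
    by (simp add: gauss_measure_def set_lebesgue_integral_eq_integral integral_unique)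
qed

text \<open>A countable set is Lebesgue null, so \<open>E\<close> is measurable and the two
  integrands agree almost everywhere.\<close>

lemma gauss_measure_diff_countable:
  assumes "E \<subseteq> S" "countable (S - E)" "S \<in> sets lebesgue"
  shows "gauss_measure E = gauss_measure S"
proof -
  have null: "S - E \<in> null_sets lebesgue"
    using assms(2) countable_imp_null_set_lborel by (metis null_sets_completionI)
  then have E: "E \<in> sets lebesgue"
    using assms(1,3) by (metis Diff_Diff_Int inf.absorb_iff2 null_setsD2 sets.Diff)
  have meas: "(\<lambda>t::real. 1 / (1 + t)) \<in> borel_measurable lebesgue"
    by (intro measurable_completion) auto
  have "(LINT t:E|lebesgue. 1 / (1 + t)) = (LINT t:S|lebesgue. 1 / (1 + t))"
    unfolding set_lebesgue_integral_def
  proof (rule integral_cong_AE)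
    show "AE t in lebesgue. indicat_real E t *\<^sub>R (1 / (1 + t)) = indicat_real S t *\<^sub>R (1 / (1 + t))"
      by (rule AE_I'[OF null]) (use assms(1) in \<open>auto simp: indicator_def\<close>)
  qed (intro borel_measurable_scaleR borel_measurable_indicator E assms(3) meas)+
  then show ?thesis by (simp add: gauss_measure_def)
qed

text \<open>The only points of the closed interval that \<open>cf_real\<close> can miss on the
  cylinder are images of 0, 1 and rationals, a countable set; the absolute value absorbs the
  orientation of \<open>cf_map w\<close>.\<close>

lemma gauss_cyl_eq: "gauss_cyl w = \<bar>ln (1 + cf_map w 1) - ln (1 + cf_map w 0)\<bar> / ln 2"
proof -
  define a b where "a = min (cf_map w 0) (cf_map w 1)" and "b = max (cf_map w 0) (cf_map w 1)"
  have ab: "0 \<le> a" "a \<le> b" using cf_map_bounds[of 0 w] cf_map_bounds[of 1 w] by (auto simp: a_def b_def)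
  have S: "cf_map w ` {0..1} = {a..b}"
    by (auto simp: cf_map_image closed_segment_eq_real_ivl a_def b_def)
  have sub: "range cf_real \<subseteq> {0..1}" using cf_real_bounds by auto
  have "{a..b} - cf_real ` cylinder w \<subseteq> cf_map w ` ({0, 1} \<union> \<rat>)"
  proof
    fix y assume y: "y \<in> {a..b} - cf_real ` cylinder w"
    then obtain x where x: "0 \<le> x" "x \<le> 1" "y = cf_map w x" unfolding S[symmetric] by auto
    then have "x \<notin> range cf_real" using y unfolding cf_real_cylinder by blast
    then have "x \<in> {0, 1} \<union> \<rat>" using irrational_in_range_cf_real[of x] x by force
    then show "y \<in> cf_map w ` ({0, 1} \<union> \<rat>)" using x by blast
  qed
  then have "countable ({a..b} - cf_real ` cylinder w)"
    by (rule countable_subset) (auto intro!: countable_image simp: countable_rat)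
  moreover have "cf_real ` cylinder w \<subseteq> {a..b}"
    unfolding S[symmetric] cf_real_cylinder using sub by blast
  ultimately have "gauss_cyl w = gauss_measure {a..b}"
    unfolding gauss_cyl_def by (intro gauss_measure_diff_countable) auto
  also have "\<dots> = \<bar>ln (1 + cf_map w 1) - ln (1 + cf_map w 0)\<bar> / ln 2"
    using gauss_measure_Icc[OF ab] ab by (auto simp: a_def b_def max_def min_def split: if_splits)
  finally show ?thesis .
qed

text \<open>The density \<open>1 / (1 + t)\<close> lies between 1/2 and 1 on the unit interval; here
  this comes from \<open>ln u \<le> u - 1\<close> applied to a quotient and to its inverse.\<close>

lemma abs_ln_diff_bounds:
  fixes x y :: real
  assumes "0 \<le> x" "x \<le> 1" "0 \<le> y" "y \<le> 1"
  shows "\<bar>x - y\<bar> / 2 \<le> \<bar>ln (1 + x) - ln (1 + y)\<bar>" "\<bar>ln (1 + x) - ln (1 + y)\<bar> \<le> \<bar>x - y\<bar>"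
proof -
  have *: "(x - y) / 2 \<le> ln (1 + x) - ln (1 + y) \<and> ln (1 + x) - ln (1 + y) \<le> x - y"
    if "0 \<le> y" "y \<le> x" "x \<le> 1" for x y :: real
  proof
    have "ln (1 + x) - ln (1 + y) = ln ((1 + x) / (1 + y))" using that by (simp add: ln_div)
    also have "\<dots> \<le> (1 + x) / (1 + y) - 1" using that by (intro ln_le_minus_one) auto
    also have "\<dots> = (x - y) / (1 + y)" using that by (simp add: field_simps)
    also have "\<dots> \<le> (x - y) / 1" using that by (intro divide_left_mono) auto
    finally show "ln (1 + x) - ln (1 + y) \<le> x - y" by simp
    have "ln (1 + y) - ln (1 + x) = ln ((1 + y) / (1 + x))" using that by (simp add: ln_div)
    also have "\<dots> \<le> (1 + y) / (1 + x) - 1" using that by (intro ln_le_minus_one) auto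
    also have "\<dots> = - ((x - y) / (1 + x))" using that by (simp add: field_simps)
    finally have "(x - y) / (1 + x) \<le> ln (1 + x) - ln (1 + y)" by simp
    moreover have "(x - y) / 2 \<le> (x - y) / (1 + x)" using that by (intro divide_left_mono) auto
    ultimately show "(x - y) / 2 \<le> ln (1 + x) - ln (1 + y)" by linarith
  qed
  consider "y \<le> x" | "x \<le> y" by linarith
  then have "\<bar>x - y\<bar> / 2 \<le> \<bar>ln (1 + x) - ln (1 + y)\<bar> \<and> \<bar>ln (1 + x) - ln (1 + y)\<bar> \<le> \<bar>x - y\<bar>"
  proof cases
    case 1
    then show ?thesis using *[OF assms(3) 1 assms(2)] by simp
  next
    case 2
    then show ?thesis using *[OF assms(1) 2 assms(4)] by simp
  qed
  then show "\<bar>x - y\<bar> / 2 \<le> \<bar>ln (1 + x) - ln (1 + y)\<bar>" "\<bar>ln (1 + x) - ln (1 + y)\<bar> \<le> \<bar>x - y\<bar>"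
    by auto
qed

lemma gauss_cyl_length:
  shows "cf_length w / (2 * ln 2) \<le> gauss_cyl w" "gauss_cyl w \<le> cf_length w / ln 2"
  using abs_ln_diff_bounds[of "cf_map w 1" "cf_map w 0"] cf_map_bounds[of 0 w] cf_map_bounds[of 1 w]
  by (auto simp: gauss_cyl_eq cf_length_def field_simps)

lemma gauss_cyl_pos: "0 < gauss_cyl w"
proof -
  have "0 < cf_length w / (2 * ln 2)" using cf_length_pos[of w] by simp
  then show ?thesis using gauss_cyl_length(1)[of w] by linarith
qed

lemma gauss_cyl_le_power: "gauss_cyl w \<le> (1 / 2) ^ length w / ln 2"
  by (rule order_trans[OF gauss_cyl_length(2)]) (simp add: divide_right_mono cf_length_le_power)

text \<open>Both ends of the new segment lie in the old one. As orientations may differ,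
  monotonicity of \<open>ln\<close> compares each inner end point with both outer ones.\<close>

lemma gauss_cyl_snoc_mono: "gauss_cyl (w @ [a]) \<le> gauss_cyl w"
proof -
  have "cf_map (w @ [a]) t \<in> closed_segment (cf_map w 0) (cf_map w 1)" if "t \<in> {0, 1}" for t
  proof -
    have "cf_map [a] t \<in> {0..1}" using cf_map_bounds[of t "[a]"] that by auto
    then show ?thesis unfolding cf_map_append cf_map_image[symmetric] by (rule imageI)
  qed
  note * = this[of 0] this[of 1]
  define l r L R where lr: "l = cf_map (w @ [a]) 0" "r = cf_map (w @ [a]) 1"
    "L = cf_map w 0" "R = cf_map w 1"
  have mono: "ln (1 + x) \<le> ln (1 + y)" if "0 \<le> x" "x \<le> y" for x y :: real using that by simp
  have "\<bar>ln (1 + r) - ln (1 + l)\<bar> \<le> \<bar>ln (1 + R) - ln (1 + L)\<bar>"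
  proof (cases "L \<le> R")
    case True
    then have "L \<le> l" "l \<le> R" "L \<le> r" "r \<le> R" "0 \<le> L"
      using * cf_map_bounds[of 0 w] by (auto simp: lr closed_segment_eq_real_ivl)
    then show ?thesis using mono[of L l] mono[of l R] mono[of L r] mono[of r R] by linarith
  next
    case False
    then have "R \<le> l" "l \<le> L" "R \<le> r" "r \<le> L" "0 \<le> R"
      using * cf_map_bounds[of 1 w] by (auto simp: lr closed_segment_eq_real_ivl)
    then show ?thesis using mono[of R l] mono[of l L] mono[of R r] mono[of r L] by linarith
  qed
  then show ?thesis by (simp add: gauss_cyl_eq lr divide_right_mono)
qed

lemma gauss_cyl_append_mono: "gauss_cyl (u @ v) \<le> gauss_cyl u"
proof (induction v rule: rev_induct)
  case (snoc a v)
  then show ?case using gauss_cyl_snoc_mono[of "u @ v" a] by simp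
qed simp

text \<open>The 4 is the 2 of \<open>cf_length_snoc_le\<close> times the factor 2 lost between
  length and Gauss measure.\<close>

lemma gauss_cyl_snoc_le:
  assumes "0 < n"
  shows "gauss_cyl (w @ [n]) \<le> 4 / real n ^ 2 * gauss_cyl w"
proof -
  have "gauss_cyl (w @ [n]) \<le> 2 / (real (n + 1) * real (n + 2)) * cf_length w / ln 2"
    using gauss_cyl_length(2)[of "w @ [n]"] divide_right_mono[OF cf_length_snoc_le[of w n], of "ln 2"]
    by simp
  also have "\<dots> \<le> 2 / (real n * real n) * cf_length w / ln 2"
    using assms cf_length_pos[of w]
    by (intro divide_right_mono mult_right_mono divide_left_mono mult_mono) auto
  also have "\<dots> = 4 / real n ^ 2 * (cf_length w / (2 * ln 2))"
    by (simp add: power2_eq_square field_simps)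
  also have "\<dots> \<le> 4 / real n ^ 2 * gauss_cyl w"
    using gauss_cyl_length(1) by (intro mult_left_mono) auto
  finally show ?thesis .
qed

text \<open>The 48 is \<open>2 * 4 * 6\<close>: a factor 2 between length and Gauss measure, the 4
  of \<open>cf_length_snoc_ge\<close>, and 6 from comparing \<open>(n + 1) * (n + 2)\<close> with
  \<open>n ^ 2\<close>.\<close>

lemma gauss_cyl_snoc_ge:
  assumes "0 < n"
  shows "1 / (48 * real n ^ 2) * gauss_cyl w \<le> gauss_cyl (w @ [n])"
proof -
  have "real (n + 1) * real (n + 2) \<le> (2 * real n) * (3 * real n)"
    using assms by (intro mult_mono) auto
  then have n: "real (n + 1) * real (n + 2) \<le> 6 * real n ^ 2" by (simp add: power2_eq_square)
  have "1 / (48 * real n ^ 2) * gauss_cyl w \<le> 1 / (48 * real n ^ 2) * (cf_length w / ln 2)"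
    by (intro mult_left_mono gauss_cyl_length) auto
  also have "\<dots> = cf_length w / (4 * (6 * real n ^ 2)) / (2 * ln 2)" by (simp add: field_simps)
  also have "\<dots> \<le> cf_length w / (4 * (real (n + 1) * real (n + 2))) / (2 * ln 2)"
    using cf_length_pos[of w] n assms by (intro divide_right_mono divide_left_mono) auto
  also have "\<dots> \<le> cf_length (w @ [n]) / (2 * ln 2)"
    by (intro divide_right_mono cf_length_snoc_ge) auto
  also have "\<dots> \<le> gauss_cyl (w @ [n])" by (rule gauss_cyl_length)
  finally show ?thesis .
qed

section \<open>Hausdorff and packing dimension in ultrametric spaces\<close>

context Metric_space
begin

text \<open>The infimum at a fixed scale inside \<open>hausdorff_measure\<close>, isolated so that
  covers can be manipulated before the supremum over scales is taken.\<close>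

definition hausdorff_content :: "real \<Rightarrow> real \<Rightarrow> 'a set \<Rightarrow> ennreal" where
  "hausdorff_content s \<delta> E = (INF U\<in>{U. delta_cover \<delta> E U}. \<Sum>i. diam_pow s (U i))"

lemma hausdorff_measure_eq_SUP: "hausdorff_measure s E = (SUP \<delta>\<in>{0<..}. hausdorff_content s \<delta> E)"
  by (simp add: hausdorff_measure_def hausdorff_content_def)

lemma hausdorff_content_antimono:
  assumes "\<delta> \<le> \<delta>'"
  shows "hausdorff_content s \<delta>' E \<le> hausdorff_content s \<delta> E"
  unfolding hausdorff_content_def
  by (intro INF_superset_mono) (use assms in \<open>force simp: delta_cover_def\<close>)+

text \<open>Near-optimal covers of the pieces, with errors \<open>e * (1 / 2) ^ Suc i\<close> adding
  up to \<open>e\<close>, are merged into one sequence by the pairing function.\<close>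

lemma hausdorff_content_UN_le:
  assumes "E \<subseteq> (\<Union>i. F i)"
  shows "hausdorff_content s \<delta> E \<le> (\<Sum>i. hausdorff_content s \<delta> (F i))"
proof (rule ennreal_le_epsilon)
  fix e :: real assume fin: "(\<Sum>i. hausdorff_content s \<delta> (F i)) < top" and e: "0 < e"
  have "\<exists>U. delta_cover \<delta> (F i) U \<and>
    (\<Sum>j. diam_pow s (U j)) \<le> hausdorff_content s \<delta> (F i) + ennreal (e * (1 / 2) ^ Suc i)" for i
  proof -
    have "hausdorff_content s \<delta> (F i) < top" using fin by (rule ennreal_suminf_lessD)
    \<comment> \<open>Finiteness makes the enlarged value strictly larger, so some cover has weight
      below it.\<close>
    moreover have "x < x + ennreal r" if "x < top" "0 < r" for x r
      using that by (cases x) (auto simp flip: ennreal_plus simp: ennreal_less_iff)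
    ultimately have "hausdorff_content s \<delta> (F i) <
        hausdorff_content s \<delta> (F i) + ennreal (e * (1 / 2) ^ Suc i)" using e by simp
    then show ?thesis
      unfolding hausdorff_content_def INF_less_iff by (auto intro: less_imp_le)
  qed
  then obtain U where U: "\<And>i. delta_cover \<delta> (F i) (U i)"
    "\<And>i. (\<Sum>j. diam_pow s (U i j)) \<le> hausdorff_content s \<delta> (F i) + ennreal (e * (1 / 2) ^ Suc i)"
    by metis
  define V where "V = (\<lambda>n. case prod_decode n of (i, j) \<Rightarrow> U i j)"
  have "delta_cover \<delta> E V"
    unfolding delta_cover_def
  proof (intro conjI allI)
    show "E \<subseteq> (\<Union>n. V n)"
    proof
      fix x assume "x \<in> E"
      then obtain i where "x \<in> F i" using assms by blast
      then obtain j where "x \<in> U i j" using U(1)[of i] by (auto simp: delta_cover_def)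
      then have "x \<in> V (prod_encode (i, j))" by (simp add: V_def)
      then show "x \<in> (\<Union>n. V n)" by blast
    qed
    fix n
    obtain i j where "prod_decode n = (i, j)" by fastforce
    then have "V n = U i j" by (simp add: V_def)
    then show "V n \<subseteq> M" "\<forall>x\<in>V n. \<forall>y\<in>V n. d x y \<le> \<delta>"
      using U(1)[of i] by (auto simp: delta_cover_def)
  qed
  then have "hausdorff_content s \<delta> E \<le> (\<Sum>n. diam_pow s (V n))"
    unfolding hausdorff_content_def by (intro INF_lower) simp
  also have "\<dots> = (\<Sum>n. (case prod_decode n of (i, j) \<Rightarrow> diam_pow s (U i j)))"
    by (intro suminf_cong) (simp add: V_def split: prod.split)
  also have "\<dots> = (\<Sum>i. \<Sum>j. diam_pow s (U i j))"
    by (subst suminf_ennreal_2dimen[where g = "\<lambda>i. \<Sum>j. diam_pow s (U i j)"]) auto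
  also have "\<dots> \<le> (\<Sum>i. hausdorff_content s \<delta> (F i) + ennreal (e * (1 / 2) ^ Suc i))"
    by (intro suminf_le U(2) summableI)
  also have "\<dots> = (\<Sum>i. hausdorff_content s \<delta> (F i)) + (\<Sum>i. ennreal (e * (1 / 2) ^ Suc i))"
    by (intro suminf_add[symmetric] summableI)
  also have "(\<Sum>i. ennreal (e * (1 / 2) ^ Suc i)) = ennreal e"
    using sums_mult[OF power_half_series, of e] e by (intro suminf_ennreal_eq) auto
  finally show "hausdorff_content s \<delta> E \<le> (\<Sum>i. hausdorff_content s \<delta> (F i)) + ennreal e" .
qed

lemma hausdorff_measure_UN_le:
  assumes "E \<subseteq> (\<Union>i. F i)"
  shows "hausdorff_measure s E \<le> (\<Sum>i. hausdorff_measure s (F i))"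
  unfolding hausdorff_measure_eq_SUP[of s E]
proof (rule SUP_least)
  fix \<delta> :: real assume "\<delta> \<in> {0<..}"
  then show "hausdorff_content s \<delta> E \<le> (\<Sum>i. hausdorff_measure s (F i))"
    unfolding hausdorff_measure_eq_SUP
    by (intro order_trans[OF hausdorff_content_UN_le[OF assms]] suminf_le summableI SUP_upper)
qed

text \<open>Turns a countable cover given as a set into the sequence that \<open>delta_cover\<close>
  demands.\<close>

lemma hausdorff_content_le_infsum:
  assumes "countable \<B>" "E \<subseteq> \<Union>\<B>"
    and \<B>: "\<And>B. B \<in> \<B> \<Longrightarrow> B \<subseteq> M" "\<And>B x y. B \<in> \<B> \<Longrightarrow> x \<in> B \<Longrightarrow> y \<in> B \<Longrightarrow> d x y \<le> \<delta>"
  shows "hausdorff_content s \<delta> E \<le> (\<Sum>\<^sub>\<infinity>B\<in>\<B>. diam_pow s B)"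
proof -
  define I where "I = to_nat_on \<B> ` \<B>"
  \<comment> \<open>Indices outside \<open>I\<close> receive the empty set, whose weight is 0 even
    for \<open>s = 0\<close>.\<close>
  define U where "U = (\<lambda>i. if i \<in> I then from_nat_into \<B> i else {})"
  have U: "U i \<in> \<B>" if "i \<in> I" for i
    using that assms(1) by (auto simp: U_def I_def)
  have "delta_cover \<delta> E U"
    unfolding delta_cover_def
  proof (intro conjI allI)
    show "E \<subseteq> (\<Union>i. U i)"
    proof
      fix x assume "x \<in> E"
      then obtain B where "B \<in> \<B>" "x \<in> B" using assms(2) by blast
      then have "x \<in> U (to_nat_on \<B> B)" using assms(1) by (simp add: U_def I_def)
      then show "x \<in> (\<Union>i. U i)" by blast
    qed
    fix i
    show "U i \<subseteq> M" using U[of i] \<B>(1) by (cases "i \<in> I") (auto simp: U_def)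
    show "\<forall>x\<in>U i. \<forall>y\<in>U i. d x y \<le> \<delta>"
      using U[of i] \<B>(2) by (cases "i \<in> I") (auto simp: U_def)
  qed
  then have "hausdorff_content s \<delta> E \<le> (\<Sum>i. diam_pow s (U i))"
    unfolding hausdorff_content_def by (intro INF_lower) simp
  also have "\<dots> \<le> (\<Sum>\<^sub>\<infinity>B\<in>\<B>. diam_pow s B)"
  proof (rule suminf_le_const[OF summableI])
    fix n
    have "(\<Sum>i<n. diam_pow s (U i)) = (\<Sum>i\<in>{..<n} \<inter> I. diam_pow s (U i))"
      by (intro sum.mono_neutral_right) (auto simp: U_def diam_pow_def)
    also have "\<dots> = (\<Sum>B\<in>U ` ({..<n} \<inter> I). diam_pow s B)"
    proof -
      have "inj_on U ({..<n} \<inter> I)"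
        by (rule inj_on_inverseI[where g = "to_nat_on \<B>"]) (use assms(1) in \<open>auto simp: U_def I_def\<close>)
      then show ?thesis by (simp add: sum.reindex)
    qed
    also have "\<dots> \<le> (\<Sum>\<^sub>\<infinity>B\<in>\<B>. diam_pow s B)"
      by (subst nonneg_infsum_complete) (use U in \<open>auto intro!: SUP_upper\<close>)
    finally show "(\<Sum>i<n. diam_pow s (U i)) \<le> (\<Sum>\<^sub>\<infinity>B\<in>\<B>. diam_pow s B)" .
  qed
  finally show ?thesis .
qed

text \<open>In an ultrametric space the balls of a fixed radius \<open>\<delta>\<close> around the points of \<open>E\<close> are at the
  same time a packing and a cover of \<open>E\<close> by sets of diameter at most \<open>\<delta>\<close>.\<close>

lemma hausdorff_measure_le_packing_premeasure:
  assumes ultra: "\<And>x y z. x \<in> M \<Longrightarrow> y \<in> M \<Longrightarrow> z \<in> M \<Longrightarrow> d x z \<le> max (d x y) (d y z)"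
    and countable: "\<And>\<delta>. 0 < \<delta> \<Longrightarrow> countable ((\<lambda>x. mcball x \<delta>) ` M)"
    and "E \<subseteq> M"
  shows "hausdorff_measure s E \<le> packing_premeasure s E"
  unfolding hausdorff_measure_eq_SUP packing_premeasure_def
proof (intro SUP_least INF_greatest)
  fix \<delta>1 \<delta>2 :: real assume "\<delta>1 \<in> {0<..}" "\<delta>2 \<in> {0<..}"
  \<comment> \<open>One radius small enough both for covers at scale \<open>\<delta>1\<close> and
    for packings at scale \<open>\<delta>2\<close>.\<close>
  define \<delta> where "\<delta> = min \<delta>1 \<delta>2"
  have \<delta>: "0 < \<delta>" "\<delta> \<le> \<delta>1" "\<delta> \<le> \<delta>2"
    using \<open>\<delta>1 \<in> {0<..}\<close> \<open>\<delta>2 \<in> {0<..}\<close> by (auto simp: \<delta>_def)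
  define \<B> where "\<B> = (\<lambda>x. mcball x \<delta>) ` E"
  have cB: "countable \<B>"
    unfolding \<B>_def by (rule countable_subset[OF _ countable[OF \<delta>(1)]]) (use \<open>E \<subseteq> M\<close> in blast)
  \<comment> \<open>Two balls of equal radius with a common point contain each other, so distinct
    ones are disjoint.\<close>
  have sub: "mcball x \<delta> \<subseteq> mcball y \<delta>" if "z \<in> mcball x \<delta>" "z \<in> mcball y \<delta>" for x y z
  proof
    fix t assume t: "t \<in> mcball x \<delta>"
    have "d z t \<le> max (d z x) (d x t)" "d y t \<le> max (d y z) (d z t)"
      using that t by (auto intro!: ultra)
    then show "t \<in> mcball y \<delta>" using that t by (auto simp: commute)
  qed
  have "pairwise disjnt \<B>"
    unfolding pairwise_def \<B>_def disjnt_def using sub by blast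
  then have "delta_packing \<delta>2 E \<B>"
    unfolding delta_packing_def using cB \<delta> by (auto simp: \<B>_def)
  have "hausdorff_content s \<delta>1 E \<le> hausdorff_content s \<delta> E"
    using \<delta>(2) by (rule hausdorff_content_antimono)
  also have "\<dots> \<le> (\<Sum>\<^sub>\<infinity>B\<in>\<B>. diam_pow s B)"
  proof (rule hausdorff_content_le_infsum[OF cB])
    show "E \<subseteq> \<Union>\<B>" using \<open>E \<subseteq> M\<close> \<delta>(1) by (force simp: \<B>_def)
    show "B \<subseteq> M" if "B \<in> \<B>" for B using that by (auto simp: \<B>_def)
    show "d x y \<le> \<delta>" if "B \<in> \<B>" "x \<in> B" "y \<in> B" for B x y
    proof -
      obtain z where "B = mcball z \<delta>" using \<open>B \<in> \<B>\<close> by (auto simp: \<B>_def)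
      then have "x \<in> mcball z \<delta>" "y \<in> mcball z \<delta>" using \<open>x \<in> B\<close> \<open>y \<in> B\<close> by simp_all
      then show ?thesis using ultra[of x z y] by (auto simp: commute)
    qed
  qed
  also have "\<dots> \<le> (SUP \<B>\<in>{\<B>. delta_packing \<delta>2 E \<B>}. \<Sum>\<^sub>\<infinity>B\<in>\<B>. diam_pow s B)"
    using \<open>delta_packing \<delta>2 E \<B>\<close> by (intro SUP_upper) simp
  finally show "hausdorff_content s \<delta>1 E \<le> \<dots>" .
qed

text \<open>Comparing piece by piece along any countable decomposition shows that zero packing
  measure forces zero Hausdorff measure, so the infimum defining the Hausdorff dimension runs over a
  larger set.\<close>

lemma hausdorff_dim_le_packing_dim:
  assumes ultra: "\<And>x y z. x \<in> M \<Longrightarrow> y \<in> M \<Longrightarrow> z \<in> M \<Longrightarrow> d x z \<le> max (d x y) (d y z)"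
    and countable: "\<And>\<delta>. 0 < \<delta> \<Longrightarrow> countable ((\<lambda>x. mcball x \<delta>) ` M)"
  shows "hausdorff_dim E \<le> packing_dim E"
proof -
  have "hausdorff_measure s E \<le> packing_measure s E" for s
    unfolding packing_measure_def
  proof (rule INF_greatest)
    fix F :: "nat \<Rightarrow> 'a set" assume F: "F \<in> {F. E \<subseteq> (\<Union>i. F i) \<and> (\<forall>i. F i \<subseteq> M)}"
    then have "hausdorff_measure s E \<le> (\<Sum>i. hausdorff_measure s (F i))"
      by (intro hausdorff_measure_UN_le) simp
    also have "\<dots> \<le> (\<Sum>i. packing_premeasure s (F i))"
      using F by (intro suminf_le summableI hausdorff_measure_le_packing_premeasure ultra countable) auto
    finally show "hausdorff_measure s E \<le> (\<Sum>i. packing_premeasure s (F i))" .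
  qed
  then have "hausdorff_measure s E = 0" if "packing_measure s E = 0" for s
    using that by (metis le_zero_eq)
  then show ?thesis
    unfolding hausdorff_dim_def packing_dim_def by (intro Inf_superset_mono) auto
qed

end

section \<open>The Gauss metric\<close>

lemma mem_cylinder_stem: "z \<in> cylinder (stem z n)"
  by (simp add: cylinder_stem)

lemma cylinder_nonempty: "cylinder w \<noteq> {}"
proof -
  have "stem (\<lambda>i. if i < length w then w ! i else 0) (length w) = w"
    by (intro nth_equalityI) simp_all
  then show ?thesis by (auto simp: cylinder_def)
qed

lemma cylinder_append_subset: "cylinder (v @ w) \<subseteq> cylinder v"
proof
  fix z assume "z \<in> cylinder (v @ w)"
  then have "stem z (length v) @ stem (\<lambda>i. z (length v + i)) (length w) = v @ w"
    by (simp add: cylinder_def stem_add del: append_eq_append_conv)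
  then show "z \<in> cylinder v" by (simp add: cylinder_def)
qed

lemma gauss_cyl_stem_mono:
  assumes "m \<le> n"
  shows "gauss_cyl (stem z n) \<le> gauss_cyl (stem z m)"
  using gauss_cyl_append_mono[of "stem z m" "stem (\<lambda>i. z (m + i)) (n - m)"] assms
  by (simp flip: stem_add)

lemma gauss_dist_eqI:
  assumes "\<And>i. i < n \<Longrightarrow> z i = z' i" "z n \<noteq> z' n"
  shows "gauss_dist z z' = gauss_cyl (stem z n)"
proof -
  have "(LEAST n. z n \<noteq> z' n) = n"
    using assms by (intro Least_equality) (auto simp: not_less[symmetric])
  then show ?thesis using assms(2) by (auto simp: gauss_dist_def common_prefix_def)
qed

lemma first_difference:
  fixes z z' :: "nat \<Rightarrow> 'a"
  assumes "z \<noteq> z'"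
  obtains n where "\<And>i. i < n \<Longrightarrow> z i = z' i" "z n \<noteq> z' n"
proof -
  have ex: "\<exists>n. z n \<noteq> z' n" using assms by blast
  show thesis
  proof (rule that)
    show "z (LEAST n. z n \<noteq> z' n) \<noteq> z' (LEAST n. z n \<noteq> z' n)" by (rule LeastI_ex[OF ex])
    show "z i = z' i" if "i < (LEAST n. z n \<noteq> z' n)" for i
      using not_less_Least[OF that] by simp
  qed
qed

lemma gauss_dist_commute: "gauss_dist z z' = gauss_dist z' z"
proof (cases "z = z'")
  case False
  then obtain n where n: "\<And>i. i < n \<Longrightarrow> z i = z' i" "z n \<noteq> z' n" by (rule first_difference) (rule that)
  have "stem z n = stem z' n" using n by simp
  then show ?thesis using gauss_dist_eqI[of n z z'] gauss_dist_eqI[of n z' z] n by metis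
qed simp

lemma gauss_dist_le_cylinder:
  assumes "z \<in> cylinder w" "z' \<in> cylinder w"
  shows "gauss_dist z z' \<le> gauss_cyl w"
proof (cases "z = z'")
  case True
  then show ?thesis using gauss_cyl_pos[of w] by (simp add: gauss_dist_def)
next
  case False
  then obtain n where n: "\<And>i. i < n \<Longrightarrow> z i = z' i" "z n \<noteq> z' n" by (rule first_difference) (rule that)
  have w: "stem z (length w) = w" using assms by (simp add: cylinder_def)
  then have "z' \<in> cylinder (stem z (length w))" using assms(2) by metis
  then have "\<forall>i<length w. z' i = z i" by (simp add: cylinder_stem)
  then have "length w \<le> n" using n(2) by (metis not_le)
  then show ?thesis using gauss_dist_eqI[of n z z', OF n] gauss_cyl_stem_mono[of "length w" n z] w by simp
qed

lemma gauss_dist_pos: "z \<noteq> z' \<Longrightarrow> 0 < gauss_dist z z'"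
  using gauss_cyl_pos by (simp add: gauss_dist_def)

text \<open>Let \<open>x\<close> separate from \<open>z\<close> at \<open>n\<close> and from
  \<open>y\<close> at \<open>m\<close>. If \<open>m \<le> n\<close>, monotonicity of
  \<open>gauss_cyl\<close> bounds the distance by \<open>gauss_dist x y\<close>; otherwise
  \<open>y\<close> still follows \<open>x\<close> at \<open>n\<close>, so it separates from
  \<open>z\<close> exactly there.\<close>

lemma gauss_dist_ultra: "gauss_dist x z \<le> max (gauss_dist x y) (gauss_dist y z)"
proof (cases "x = z \<or> x = y \<or> y = z")
  case True
  then show ?thesis using gauss_dist_pos[of x y] by (auto simp: gauss_dist_def gauss_cyl_pos less_imp_le max_def)
next
  case False
  then have neq: "x \<noteq> z" "x \<noteq> y" by auto
  from neq(1) obtain n where n: "\<And>i. i < n \<Longrightarrow> x i = z i" "x n \<noteq> z n" by (rule first_difference) (rule that)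
  from neq(2) obtain m where m: "\<And>i. i < m \<Longrightarrow> x i = y i" "x m \<noteq> y m"
    by (rule first_difference) (rule that)
  show ?thesis
  proof (cases "m \<le> n")
    case True
    then show ?thesis
      using gauss_dist_eqI[of n x z, OF n] gauss_dist_eqI[of m x y, OF m] gauss_cyl_stem_mono[of m n x] by simp
  next
    case False
    then have "gauss_dist y z = gauss_cyl (stem y n)" using n m by (intro gauss_dist_eqI) force+
    moreover have "stem y n = stem x n" using m False by simp
    ultimately show ?thesis using gauss_dist_eqI[of n x z, OF n] by simp
  qed
qed

interpretation gauss: Metric_space UNIV gauss_dist
proof
  show "0 \<le> gauss_dist x y" for x y
    using gauss_dist_pos[of x y] by (cases "x = y") (auto simp: gauss_dist_def)
  show "gauss_dist x y = 0 \<longleftrightarrow> x = y" for x y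
    using gauss_dist_pos[of x y] by (cases "x = y") (auto simp: gauss_dist_def)
  show "gauss_dist x y = gauss_dist y x" for x y by (rule gauss_dist_commute)
  show "gauss_dist x z \<le> gauss_dist x y + gauss_dist y z" for x y z
    using gauss_dist_ultra[of x z y] \<open>\<And>x y. 0 \<le> gauss_dist x y\<close>[of x y]
      \<open>\<And>x y. 0 \<le> gauss_dist x y\<close>[of y z] by linarith
qed

section \<open>Balls, cylinders and their diameters\<close>

lemma gauss_cyl_stem_small:
  assumes "0 < r"
  shows "\<exists>n. gauss_cyl (stem x n) \<le> r"
proof -
  obtain n where "(1 / 2) ^ n < r * ln 2" using real_arch_pow_inv[of "r * ln 2" "1 / 2"] assms by auto
  then have "(1 / 2) ^ n / ln 2 \<le> r" by (simp add: field_simps)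
  then show ?thesis using gauss_cyl_le_power[of "stem x n"] by (intro exI[of _ n]) simp
qed

text \<open>The first \<open>n\<close> whose stem has measure at most \<open>r\<close> works: a
  point leaving \<open>x\<close> at \<open>m\<close> is at distance
  \<open>gauss_cyl (stem x m)\<close>, which is at most \<open>r\<close> exactly when
  \<open>n \<le> m\<close>.\<close>

lemma gauss_mcball_eq_cylinder:
  assumes "0 < r"
  obtains n where "gauss.mcball x r = cylinder (stem x n)" "gauss_cyl (stem x n) \<le> r"
proof -
  define n where "n = (LEAST n. gauss_cyl (stem x n) \<le> r)"
  have n: "gauss_cyl (stem x n) \<le> r"
    unfolding n_def using gauss_cyl_stem_small[OF assms] by (rule LeastI_ex)
  have "gauss.mcball x r = cylinder (stem x n)"
  proof (intro set_eqI iffI)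
    fix y assume "y \<in> cylinder (stem x n)"
    then have "gauss_dist x y \<le> gauss_cyl (stem x n)"
      by (intro gauss_dist_le_cylinder mem_cylinder_stem)
    then show "y \<in> gauss.mcball x r" using n by simp
  next
    fix y assume y: "y \<in> gauss.mcball x r"
    show "y \<in> cylinder (stem x n)"
    proof (cases "x = y")
      case True
      then show ?thesis using mem_cylinder_stem by simp
    next
      case False
      then obtain m where m: "\<And>i. i < m \<Longrightarrow> x i = y i" "x m \<noteq> y m" by (rule first_difference) (rule that)
      then have "gauss_cyl (stem x m) \<le> r" using y gauss_dist_eqI[of m x y, OF m] by simp
      then have "n \<le> m" unfolding n_def by (rule Least_le)
      then show ?thesis using m by (simp add: cylinder_stem)
    qed
  qed
  then show thesis using n that by blast
qed

lemma mdiameter_cylinder: "gauss.mdiameter (cylinder w) = gauss_cyl w"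
proof -
  \<comment> \<open>Two extensions of \<open>w\<close> that differ right after it attain the
    bound.\<close>
  define x where "x = (\<lambda>i. if i < length w then w ! i else 0)"
  define y where "y = (\<lambda>i. if i < length w then w ! i else 1)"
  have st: "stem x (length w) = w" "stem y (length w) = w"
    by (intro nth_equalityI; simp add: x_def y_def)+
  then have xy: "x \<in> cylinder w" "y \<in> cylinder w" by (simp_all add: cylinder_def)
  have "gauss_dist x y = gauss_cyl (stem x (length w))"
    by (rule gauss_dist_eqI) (simp_all add: x_def y_def)
  then have "gauss_cyl w \<in> (\<lambda>(x, y). gauss_dist x y) ` (cylinder w \<times> cylinder w)"
    using xy st by (intro image_eqI[of _ _ "(x, y)"]) auto
  then have "Sup ((\<lambda>(x, y). gauss_dist x y) ` (cylinder w \<times> cylinder w)) = gauss_cyl w"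
    by (rule cSup_eq_maximum) (auto intro: gauss_dist_le_cylinder)
  then show ?thesis by (simp add: gauss.mdiameter_def cylinder_nonempty)
qed

text \<open>Positivity of \<open>gauss_cyl w\<close> makes its \<open>powr 0\<close> equal to 1, in
  accordance with the convention in \<open>diam_pow\<close>.\<close>

lemma diam_pow_cylinder: "gauss.diam_pow s (cylinder w) = ennreal (gauss_cyl w powr s)"
  using gauss_cyl_pos[of w] by (simp add: gauss.diam_pow_def cylinder_nonempty mdiameter_cylinder)

lemma dim_gauss_le_Dim_gauss: "dim_gauss E \<le> Dim_gauss E"
  unfolding dim_gauss_def Dim_gauss_def
proof (rule gauss.hausdorff_dim_le_packing_dim)
  show "countable ((\<lambda>x. gauss.mcball x \<delta>) ` UNIV)" if "0 < \<delta>" for \<delta>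
  proof (rule countable_subset)
    show "(\<lambda>x. gauss.mcball x \<delta>) ` UNIV \<subseteq> range cylinder"
      using gauss_mcball_eq_cylinder[OF that] by blast
  qed simp
qed (rule gauss_dist_ultra)

section \<open>The upper bound\<close>

text \<open>Induction on the maximal word length: a prefix-free set without the empty word splits by
  first letters into prefix-free sets of shorter words, and \<open>tail\<close> ensures that the
  children of \<open>u\<close> together weigh no more than \<open>u\<close>.\<close>

lemma kraft_inequality:
  assumes tail: "\<And>B. finite B \<Longrightarrow> B \<subseteq> A \<Longrightarrow> (\<Sum>a\<in>B. (4 / real a ^ 2) powr t) \<le> 1"
    and "A \<subseteq> {0<..}" "0 \<le> t"
    and "finite V" "\<And>v. v \<in> V \<Longrightarrow> set v \<subseteq> A"
    and "\<And>v v'. v \<in> V \<Longrightarrow> v' \<in> V \<Longrightarrow> prefix v v' \<Longrightarrow> v = v'"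
  shows "(\<Sum>v\<in>V. gauss_cyl (u @ v) powr t) \<le> gauss_cyl u powr t"
proof -
  have "(\<Sum>v\<in>V. gauss_cyl (u @ v) powr t) \<le> gauss_cyl u powr t"
    if "finite V" "\<And>v. v \<in> V \<Longrightarrow> length v \<le> n" "\<And>v. v \<in> V \<Longrightarrow> set v \<subseteq> A"
      "\<And>v v'. v \<in> V \<Longrightarrow> v' \<in> V \<Longrightarrow> prefix v v' \<Longrightarrow> v = v'" for n V u
    using that
  proof (induction n arbitrary: V u)
    case 0
    then have "V \<subseteq> {[]}" by auto
    then have "V = {} \<or> V = {[]}" by blast
    then show ?case by auto
  next
    case (Suc n)
    show ?case
    proof (cases "[] \<in> V")
      case True
      then have "v = []" if "v \<in> V" for v using Suc.prems(4)[OF True that] by simp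
      then have "V = {[]}" using True by blast
      then show ?thesis by simp
    next
      case False
      define W where "W = (\<lambda>a. {v. a # v \<in> V})"
      have inj: "inj_on ((#) a) X" for a :: nat and X by (auto simp: inj_on_def)
      have finW: "finite (W a)" for a
        unfolding W_def using finite_vimageI[OF Suc.prems(1) inj[of a UNIV]] by (simp add: vimage_def)
      have fib: "{v \<in> V. hd v = a} = (#) a ` W a" if "a \<in> hd ` V" for a
      proof (intro set_eqI iffI)
        fix v assume "v \<in> {v \<in> V. hd v = a}"
        then have "v \<in> V" "v = a # tl v" using False by (cases v; auto)+
        then show "v \<in> (#) a ` W a" by (metis W_def image_eqI mem_Collect_eq)
      qed (auto simp: W_def)
      have sub: "hd ` V \<subseteq> A"
      proof safe
        fix v assume "v \<in> V"
        then show "hd v \<in> A" using False Suc.prems(3)[of v] by (cases v) auto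
      qed
      have "(\<Sum>v\<in>V. gauss_cyl (u @ v) powr t) =
          (\<Sum>a\<in>hd ` V. \<Sum>v\<in>{v \<in> V. hd v = a}. gauss_cyl (u @ v) powr t)"
        using Suc.prems(1) by (intro sum.group[symmetric]) auto
      also have "\<dots> = (\<Sum>a\<in>hd ` V. \<Sum>v\<in>W a. gauss_cyl ((u @ [a]) @ v) powr t)"
      proof (rule sum.cong)
        fix a assume "a \<in> hd ` V"
        show "(\<Sum>v\<in>{v \<in> V. hd v = a}. gauss_cyl (u @ v) powr t) =
            (\<Sum>v\<in>W a. gauss_cyl ((u @ [a]) @ v) powr t)"
          unfolding fib[OF \<open>a \<in> hd ` V\<close>] by (simp add: sum.reindex[OF inj])
      qed simp
      also have "\<dots> \<le> (\<Sum>a\<in>hd ` V. gauss_cyl (u @ [a]) powr t)"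
      proof (intro sum_mono Suc.IH)
        fix a v assume "v \<in> W a"
        then have "a # v \<in> V" by (simp add: W_def)
        then show "length v \<le> n" "set v \<subseteq> A" using Suc.prems(2,3)[of "a # v"] by auto
      next
        fix a v v' assume "v \<in> W a" "v' \<in> W a" "prefix v v'"
        then show "v = v'" using Suc.prems(4)[of "a # v" "a # v'"] by (simp add: W_def)
      qed (rule finW)
      also have "\<dots> \<le> (\<Sum>a\<in>hd ` V. (4 / real a ^ 2) powr t * gauss_cyl u powr t)"
      proof (rule sum_mono)
        fix a assume "a \<in> hd ` V"
        then have "0 < a" using sub \<open>A \<subseteq> {0<..}\<close> by auto
        then have "gauss_cyl (u @ [a]) powr t \<le> (4 / real a ^ 2 * gauss_cyl u) powr t"
          using \<open>0 \<le> t\<close> gauss_cyl_pos[of "u @ [a]"] by (intro powr_mono2 gauss_cyl_snoc_le) auto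
        also have "\<dots> = (4 / real a ^ 2) powr t * gauss_cyl u powr t"
          by (rule powr_mult)
        finally show "gauss_cyl (u @ [a]) powr t \<le> \<dots>" .
      qed
      also have "\<dots> = (\<Sum>a\<in>hd ` V. (4 / real a ^ 2) powr t) * gauss_cyl u powr t"
        by (simp add: sum_distrib_right)
      also have "\<dots> \<le> 1 * gauss_cyl u powr t"
        using tail[of "hd ` V"] sub Suc.prems(1) by (intro mult_right_mono) auto
      finally show ?thesis by simp
    qed
  qed
  note * = this
  show ?thesis
  proof (rule *[of V "Max (length ` V)"])
    show "length v \<le> Max (length ` V)" if "v \<in> V" for v
      using that assms(4) by (intro Max_ge) auto
  qed (fact assms)+
qed

text \<open>In a \<open>\<delta>\<close>-packing each weight of exponent \<open>s\<close> is at most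
  \<open>\<delta> powr (s - t)\<close> times the weight of exponent \<open>t\<close>; Kraft bounds
  the latter in total by \<open>gauss_cyl u powr t\<close>, and \<open>\<delta>\<close> tends to
  0.\<close>

lemma packing_premeasure_eq_0:
  assumes tail: "\<And>B. finite B \<Longrightarrow> B \<subseteq> A \<Longrightarrow> (\<Sum>a\<in>B. (4 / real a ^ 2) powr t) \<le> 1"
    and "A \<subseteq> {0<..}" "0 \<le> t" "t < s"
  shows "gauss.packing_premeasure s {f \<in> cylinder u. \<forall>i\<ge>length u. f i \<in> A} = 0"
    (is "gauss.packing_premeasure s ?E = 0")
proof -
  have bound: "gauss.packing_premeasure s ?E \<le> ennreal (\<delta> powr (s - t) * gauss_cyl u powr t)"
    if \<delta>: "0 < \<delta>" "\<delta> < gauss_cyl u" for \<delta>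
  proof -
    have "(\<Sum>\<^sub>\<infinity>B\<in>\<B>. gauss.diam_pow s B) \<le> ennreal (\<delta> powr (s - t) * gauss_cyl u powr t)"
      if \<B>: "gauss.delta_packing \<delta> ?E \<B>" for \<B>
    proof -
      \<comment> \<open>A ball of radius below \<open>gauss_cyl u\<close> around a point of
        \<open>cylinder u\<close> is the cylinder of an extension of \<open>u\<close>; this is why
        \<open>\<delta> < gauss_cyl u\<close> is imposed.\<close>
      have "\<exists>v. B = cylinder (u @ v) \<and> set v \<subseteq> A \<and> gauss_cyl (u @ v) \<le> \<delta>" if "B \<in> \<B>" for B
      proof -
        obtain x r where x: "x \<in> ?E" "0 < r" "r \<le> \<delta>" "B = gauss.mcball x r"
          using \<B> \<open>B \<in> \<B>\<close> unfolding gauss.delta_packing_def by blast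
        obtain n where n: "B = cylinder (stem x n)" "gauss_cyl (stem x n) \<le> r"
          using gauss_mcball_eq_cylinder[OF x(2)] x(4) by metis
        have u: "stem x (length u) = u" using x(1) by (simp add: cylinder_def)
        have "length u \<le> n"
        proof (rule ccontr)
          assume "\<not> length u \<le> n"
          then have "gauss_cyl u \<le> gauss_cyl (stem x n)"
            using gauss_cyl_stem_mono[of n "length u" x] u by simp
          then show False using n(2) x(3) \<delta> by simp
        qed
        then have "stem x n = u @ stem (\<lambda>i. x (length u + i)) (n - length u)"
          using stem_add[of x "length u" "n - length u"] u by simp
        moreover have "set (stem (\<lambda>i. x (length u + i)) (n - length u)) \<subseteq> A" using x(1) by auto
        ultimately show ?thesis using n x(3) by (metis order_trans)
      qed
      then obtain v where v: "\<And>B. B \<in> \<B> \<Longrightarrow> B = cylinder (u @ v B)" "\<And>B. B \<in> \<B> \<Longrightarrow> set (v B) \<subseteq> A"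
        "\<And>B. B \<in> \<B> \<Longrightarrow> gauss_cyl (u @ v B) \<le> \<delta>" by metis
      have "sum (gauss.diam_pow s) \<F> \<le> ennreal (\<delta> powr (s - t) * gauss_cyl u powr t)"
        if \<F>: "\<F> \<subseteq> \<B>" "finite \<F>" for \<F>
      proof -
        \<comment> \<open>A prefix relation would nest the two balls, contradicting disjointness; so
          the words are prefix-free and \<open>v\<close> is injective.\<close>
        have anti: "B = B'" if B: "B \<in> \<F>" "B' \<in> \<F>" and pre: "prefix (v B) (v B')" for B B'
        proof (rule ccontr)
          assume "B \<noteq> B'"
          then have "disjnt B B'" using \<B> \<F> B unfolding gauss.delta_packing_def pairwise_def by blast
          moreover have "B' \<subseteq> B"
          proof -
            obtain z where "v B' = v B @ z" using pre by (auto simp: prefix_def)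
            then have "cylinder (u @ v B') \<subseteq> cylinder (u @ v B)"
              using cylinder_append_subset[of "u @ v B" z] by simp
            then show ?thesis using v(1) \<F>(1) B by blast
          qed
          moreover have "B' \<noteq> {}" using v(1)[of B'] \<F>(1) B(2) cylinder_nonempty by blast
          ultimately show False by (auto simp: disjnt_def)
        qed
        have inj: "inj_on v \<F>" by (rule inj_onI, rule anti) simp_all
        have "sum (gauss.diam_pow s) \<F> = (\<Sum>B\<in>\<F>. ennreal (gauss_cyl (u @ v B) powr s))"
        proof (rule sum.cong)
          fix B assume "B \<in> \<F>"
          then show "gauss.diam_pow s B = ennreal (gauss_cyl (u @ v B) powr s)"
            using v(1)[of B] \<F>(1) diam_pow_cylinder[of s "u @ v B"] by auto
        qed simp
        also have "\<dots> = ennreal (\<Sum>B\<in>\<F>. gauss_cyl (u @ v B) powr s)" by (simp add: sum_ennreal)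
        also have "\<dots> \<le> ennreal (\<delta> powr (s - t) * gauss_cyl u powr t)"
        proof (rule ennreal_leI)
          have "(\<Sum>B\<in>\<F>. gauss_cyl (u @ v B) powr s) \<le>
              (\<Sum>B\<in>\<F>. \<delta> powr (s - t) * gauss_cyl (u @ v B) powr t)"
          proof (rule sum_mono)
            fix B assume "B \<in> \<F>"
            then have B: "gauss_cyl (u @ v B) \<le> \<delta>" using v(3) \<F>(1) by blast
            have "gauss_cyl (u @ v B) powr s =
                gauss_cyl (u @ v B) powr (s - t) * gauss_cyl (u @ v B) powr t"
              by (simp flip: powr_add)
            also have "\<dots> \<le> \<delta> powr (s - t) * gauss_cyl (u @ v B) powr t"
              using B \<open>t < s\<close> gauss_cyl_pos[of "u @ v B"] by (intro mult_right_mono powr_mono2) auto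
            finally show "gauss_cyl (u @ v B) powr s \<le> \<dots>" .
          qed
          also have "\<dots> = \<delta> powr (s - t) * (\<Sum>w\<in>v ` \<F>. gauss_cyl (u @ w) powr t)"
            by (simp add: sum_distrib_left sum.reindex[OF inj])
          also have "\<dots> \<le> \<delta> powr (s - t) * gauss_cyl u powr t"
          proof (intro mult_left_mono kraft_inequality[of A t])
            show "set w \<subseteq> A" if "w \<in> v ` \<F>" for w using that v(2) \<F>(1) by auto
            show "w = w'" if "w \<in> v ` \<F>" "w' \<in> v ` \<F>" "prefix w w'" for w w'
            proof -
              obtain B B' where B: "B \<in> \<F>" "w = v B" "B' \<in> \<F>" "w' = v B'" using \<open>w \<in> _\<close> \<open>w' \<in> _\<close> by blast
              then show ?thesis using anti[of B B'] \<open>prefix w w'\<close> by simp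
            qed
          qed (use tail assms(2,3) \<F>(2) in auto)
          finally show "(\<Sum>B\<in>\<F>. gauss_cyl (u @ v B) powr s) \<le> \<delta> powr (s - t) * gauss_cyl u powr t" .
        qed
        finally show ?thesis .
      qed
      then show ?thesis
        by (subst nonneg_infsum_complete) (auto intro!: SUP_least)
    qed
    then show ?thesis
      unfolding gauss.packing_premeasure_def
      by (intro INF_lower2[of \<delta>] SUP_least) (use \<delta> in auto)
  qed
  define K where "K = gauss_cyl u powr t"
  have K: "0 < K" using gauss_cyl_pos[of u] by (simp add: K_def)
  have "gauss.packing_premeasure s ?E \<le> 0"
  proof (rule ennreal_le_epsilon)
    fix e :: real assume e: "0 < e"
    \<comment> \<open>The first bound keeps \<open>\<delta>\<close> below
      \<open>gauss_cyl u\<close>, the second is the solution of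
      \<open>\<delta> powr (s - t) * K = e\<close>.\<close>
    define \<delta> where "\<delta> = min (gauss_cyl u / 2) ((e / K) powr (1 / (s - t)))"
    have \<delta>: "0 < \<delta>" "\<delta> < gauss_cyl u" using gauss_cyl_pos[of u] e K by (auto simp: \<delta>_def)
    have "\<delta> powr (s - t) \<le> ((e / K) powr (1 / (s - t))) powr (s - t)"
      using \<delta> \<open>t < s\<close> by (intro powr_mono2) (auto simp: \<delta>_def)
    also have "\<dots> = e / K" using e K \<open>t < s\<close> by (simp add: powr_powr)
    finally have "\<delta> powr (s - t) * K \<le> e" using K by (simp add: field_simps)
    then have "\<delta> powr (s - t) * gauss_cyl u powr t \<le> e" by (simp add: K_def)
    from order_trans[OF bound[OF \<delta>] ennreal_leI[OF this]]
    show "gauss.packing_premeasure s ?E \<le> 0 + ennreal e" by simp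
  qed
  then show ?thesis by simp
qed

section \<open>Tails of sums of nonnegative terms\<close>

lemma summable_on_tail_small:
  fixes g :: "nat \<Rightarrow> real"
  assumes "g summable_on A" "\<And>n. 0 \<le> g n" "0 < e"
  obtains N where "\<And>B. finite B \<Longrightarrow> B \<subseteq> A \<inter> {N..} \<Longrightarrow> sum g B \<le> e"
proof -
  have "(sum g \<longlongrightarrow> infsum g A) (finite_subsets_at_top A)"
    using assms(1) has_sum_def has_sum_infsum by blast
  then have "\<forall>\<^sub>F F in finite_subsets_at_top A. infsum g A - e < sum g F"
    using \<open>0 < e\<close> by (intro order_tendstoD) auto
  \<comment> \<open>\<open>F\<close> collects all but \<open>e\<close> of the sum, and a set beyond
    its largest element is disjoint from it, so at most \<open>e\<close> is left for that
    set.\<close>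
  then obtain F where F: "finite F" "F \<subseteq> A" "infsum g A - e < sum g F"
    unfolding eventually_finite_subsets_at_top by blast
  obtain N where N: "\<forall>n\<in>F. n < N" using F(1) finite_nat_set_iff_bounded[of F] by auto
  show thesis
  proof (rule that)
    fix B assume B: "finite B" "B \<subseteq> A \<inter> {N..}"
    have "F \<inter> B = {}" using N B by force
    then have "sum g F + sum g B = sum g (F \<union> B)" using F B by (simp add: sum.union_disjoint)
    also have "\<dots> \<le> infsum g A" using F B assms by (intro finite_sum_le_infsum) auto
    finally show "sum g B \<le> e" using F(3) by linarith
  qed
qed

text \<open>Dropping the finitely many terms below \<open>N\<close> cannot restore summability, and
  for nonnegative terms failure of summability means unbounded finite sums.\<close>

lemma not_summable_on_tail_large:
  fixes g :: "nat \<Rightarrow> real"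
  assumes "\<not> g summable_on A" "\<And>n. 0 \<le> g n"
  obtains B where "finite B" "B \<subseteq> A \<inter> {N..}" "K \<le> sum g B"
proof -
  have "\<not> g summable_on (A \<inter> {N..})"
  proof
    assume "g summable_on (A \<inter> {N..})"
    moreover have "g summable_on (A \<inter> {..<N})" by (rule summable_on_finite) simp
    ultimately have "g summable_on ((A \<inter> {N..}) \<union> (A \<inter> {..<N}))" by (rule summable_on_union)
    moreover have "(A \<inter> {N..}) \<union> (A \<inter> {..<N}) = A" by auto
    ultimately show False using assms(1) by simp
  qed
  then have "\<not> bdd_above (sum g ` {F. F \<subseteq> A \<inter> {N..} \<and> finite F})"
    using nonneg_bdd_above_summable_on[of "A \<inter> {N..}" g] assms(2) by blast
  then have "\<exists>B. finite B \<and> B \<subseteq> A \<inter> {N..} \<and> K \<le> sum g B"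
    by (rule contrapos_np) (auto intro!: bdd_aboveI2[where M = K] less_imp_le simp: not_le)
  then show thesis by (elim exE conjE) (rule that)
qed

text \<open>The exponent 2 always works; without a member the real infimum in
  \<open>zeta_dim\<close> would carry no information.\<close>

lemma zeta_exponents_nonempty: "{s. 0 \<le> s \<and> (\<lambda>n. real n powr (- s)) summable_on A} \<noteq> {}"
proof -
  have "(\<lambda>n. real n powr (- 2)) summable_on UNIV"
    by (intro summable_nonneg_imp_summable_on) (simp_all add: summable_real_powr_iff)
  then have "(\<lambda>n. real n powr (- 2)) summable_on A" by (rule summable_on_subset) simp
  then show ?thesis by force
qed

text \<open>An exponent \<open>t' = 2 * t < 2 * s\<close> with convergent zeta sum is chosen, and
  \<open>N\<close> so large that the tail from \<open>N\<close> on offsets the factor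
  \<open>4 powr t\<close> from \<open>gauss_cyl_snoc_le\<close>. Every sequence in the set
  eventually stays in \<open>A \<inter> {N..}\<close>.\<close>

lemma packing_measure_divergent_seqs:
  assumes "A \<subseteq> {0<..}" "zeta_dim A < 2 * s"
  shows "gauss.packing_measure s (divergent_seqs A) = 0"
proof -
  let ?S = "{s. 0 \<le> s \<and> (\<lambda>n. real n powr (- s)) summable_on A}"
  have "?S \<noteq> {}" by (rule zeta_exponents_nonempty)
  moreover have "bdd_below ?S" by (rule bdd_belowI[of _ 0]) simp
  ultimately obtain t' where t': "0 \<le> t'" "(\<lambda>n. real n powr (- t')) summable_on A" "t' < 2 * s"
    using assms(2) unfolding zeta_dim_def by (auto simp: cInf_less_iff)
  define t where "t = t' / 2"
  have t: "0 \<le> t" "t < s" "t' = 2 * t" using t' by (auto simp: t_def)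
  obtain N where N: "\<And>B. finite B \<Longrightarrow> B \<subseteq> A \<inter> {N..} \<Longrightarrow> (\<Sum>a\<in>B. real a powr (- t')) \<le> 1 / 4 powr t"
    by (rule summable_on_tail_small[OF t'(2), of "1 / 4 powr t"]) auto
  define E where "E = (\<lambda>u. {f \<in> cylinder u. \<forall>i\<ge>length u. f i \<in> A \<inter> {N..}})"
  have "(\<Sum>a\<in>B. (4 / real a ^ 2) powr t) \<le> 1" if "finite B" "B \<subseteq> A \<inter> {N..}" for B
  proof -
    have "(\<Sum>a\<in>B. (4 / real a ^ 2) powr t) = (\<Sum>a\<in>B. 4 powr t * real a powr (- t'))"
    proof (rule sum.cong)
      fix a assume "a \<in> B"
      then have "0 < a" using that assms(1) by auto
      then show "(4 / real a ^ 2) powr t = 4 powr t * real a powr (- t')"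
        by (simp add: t(3) powr_divide powr_minus_divide powr_powr flip: powr_numeral)
    qed simp
    also have "\<dots> = 4 powr t * (\<Sum>a\<in>B. real a powr (- t'))" by (simp add: sum_distrib_left)
    also have "\<dots> \<le> 4 powr t * (1 / 4 powr t)" using N[OF that] by (intro mult_left_mono) auto
    finally show ?thesis by simp
  qed
  then have zero: "gauss.packing_premeasure s (E u) = 0" for u
    unfolding E_def by (rule packing_premeasure_eq_0) (use assms(1) t in auto)
  \<comment> \<open>Words are countable, so \<open>from_nat\<close> enumerates all the sets
    \<open>E u\<close>, each of premeasure 0.\<close>
  have "divergent_seqs A \<subseteq> (\<Union>i. E (from_nat i))"
  proof
    fix f assume f: "f \<in> divergent_seqs A"
    then have "eventually (\<lambda>n. N \<le> f n) sequentially"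
      by (auto simp: divergent_seqs_def filterlim_at_top)
    then obtain n where "\<And>i. i \<ge> n \<Longrightarrow> N \<le> f i" by (auto simp: eventually_sequentially)
    then have "f \<in> E (stem f n)"
      using f mem_cylinder_stem[of f n] by (auto simp: E_def divergent_seqs_def)
    then show "f \<in> (\<Union>i. E (from_nat i))" by (intro UN_I[of "to_nat (stem f n)"]) auto
  qed
  then have "gauss.packing_measure s (divergent_seqs A) \<le>
      (\<Sum>i. gauss.packing_premeasure s (E (from_nat i)))"
    unfolding gauss.packing_measure_def by (intro INF_lower) auto
  then show ?thesis by (simp add: zero)
qed

section \<open>The lower bound\<close>

text \<open>A branch of the tree is chosen greedily so that at every node \<open>u\<close> the cylinders of the cover
  inside \<open>u\<close> have total weight less than \<open>\<gamma>(u)\<^sup>s\<close>; in particular \<open>u\<close> is never one of them.\<close>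

lemma exists_uncovered_divergent_seq:
  fixes w :: "nat \<Rightarrow> nat list" and e :: "nat \<Rightarrow> ennreal"
  assumes large: "\<And>k. \<exists>B. finite B \<and> B \<subseteq> A \<inter> {k..} \<and> 1 \<le> (\<Sum>a\<in>B. (1 / (48 * real a ^ 2)) powr s)"
    and "A \<subseteq> {0<..}" "0 \<le> s"
    and e: "(\<Sum>i. e i) < ennreal (gauss_cyl [] powr s)"
    and w: "\<And>i. i \<in> I \<Longrightarrow> ennreal (gauss_cyl (w i) powr s) \<le> e i"
  shows "\<exists>f\<in>divergent_seqs A. \<forall>i\<in>I. f \<notin> cylinder (w i)"
proof -
  \<comment> \<open>\<open>T u\<close> is the total budget of the listed words that extend
    \<open>u\<close>, the word \<open>u\<close> itself included.\<close>
  define T where "T = (\<lambda>u. \<Sum>i. if i \<in> I \<and> prefix u (w i) then e i else 0)"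
  have step: "\<exists>a\<in>A. length u \<le> a \<and> T (u @ [a]) < ennreal (gauss_cyl (u @ [a]) powr s)"
    if u: "T u < ennreal (gauss_cyl u powr s)" for u
  proof (rule ccontr)
    assume contra: "\<not> ?thesis"
    \<comment> \<open>Taking \<open>k = length u\<close> makes the \<open>n\<close>-th letter of the
      branch at least \<open>n\<close>, which forces divergence.\<close>
    from large[of "length u"] obtain B where B: "finite B" "B \<subseteq> A \<inter> {length u..}"
      "1 \<le> (\<Sum>a\<in>B. (1 / (48 * real a ^ 2)) powr s)" by (elim exE conjE) (rule that)
    have "gauss_cyl u powr s \<le> (\<Sum>a\<in>B. (1 / (48 * real a ^ 2)) powr s) * gauss_cyl u powr s"
      using mult_right_mono[OF B(3), of "gauss_cyl u powr s"] by simp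
    also have "\<dots> \<le> (\<Sum>a\<in>B. gauss_cyl (u @ [a]) powr s)"
      unfolding sum_distrib_right
    proof (rule sum_mono)
      fix a assume "a \<in> B"
      then have "0 < a" using B \<open>A \<subseteq> {0<..}\<close> by auto
      have "(1 / (48 * real a ^ 2)) powr s * gauss_cyl u powr s = (1 / (48 * real a ^ 2) * gauss_cyl u) powr s"
        by (rule powr_mult[symmetric])
      also have "\<dots> \<le> gauss_cyl (u @ [a]) powr s"
        using \<open>0 < a\<close> \<open>0 \<le> s\<close> gauss_cyl_pos[of u] by (intro powr_mono2 gauss_cyl_snoc_ge) auto
      finally show "(1 / (48 * real a ^ 2)) powr s * gauss_cyl u powr s \<le> gauss_cyl (u @ [a]) powr s" .
    qed
    finally have "ennreal (gauss_cyl u powr s) \<le> ennreal (\<Sum>a\<in>B. gauss_cyl (u @ [a]) powr s)"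
      by (rule ennreal_leI)
    also have "\<dots> = (\<Sum>a\<in>B. ennreal (gauss_cyl (u @ [a]) powr s))" by (simp add: sum_ennreal)
    also have "\<dots> \<le> (\<Sum>a\<in>B. T (u @ [a]))"
    proof (rule sum_mono)
      fix a assume "a \<in> B"
      then have "a \<in> A" "length u \<le> a" using B by auto
      then show "ennreal (gauss_cyl (u @ [a]) powr s) \<le> T (u @ [a])" using contra not_less by blast
    qed
    also have "\<dots> = (\<Sum>i. \<Sum>a\<in>B. if i \<in> I \<and> prefix (u @ [a]) (w i) then e i else 0)"
      unfolding T_def by (intro suminf_sum[symmetric] summableI)
    also have "\<dots> \<le> T u"
      unfolding T_def
    proof (intro suminf_le summableI)
      fix i
      \<comment> \<open>Each \<open>w i\<close> extends at most one child of \<open>u\<close>, the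
        one with letter \<open>w i ! length u\<close>; for \<open>w i = u\<close> that letter is
        arbitrary, but then the left side is 0.\<close>
      have "(\<Sum>a\<in>B. if i \<in> I \<and> prefix (u @ [a]) (w i) then e i else 0) \<le>
         (\<Sum>a\<in>B. if a = w i ! length u then (if i \<in> I \<and> prefix u (w i) then e i else 0) else 0)"
        by (intro sum_mono) (auto simp: prefix_def)
      also have "\<dots> \<le> (if i \<in> I \<and> prefix u (w i) then e i else 0)"
        using B(1) by simp
      finally show "(\<Sum>a\<in>B. if i \<in> I \<and> prefix (u @ [a]) (w i) then e i else 0) \<le>
        (if i \<in> I \<and> prefix u (w i) then e i else 0)" .
    qed
    finally show False using u by simp
  qed
  have "\<exists>g. \<forall>n. (length (g n) = n \<and> T (g n) < ennreal (gauss_cyl (g n) powr s)) \<and>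
      (\<exists>a\<in>A. n \<le> a \<and> g (Suc n) = g n @ [a])"
  proof (rule dependent_nat_choice)
    have "T [] \<le> (\<Sum>i. e i)" unfolding T_def by (intro suminf_le summableI) auto
    then show "\<exists>x. length x = 0 \<and> T x < ennreal (gauss_cyl x powr s)" using e by auto
  next
    fix x n assume "length x = n \<and> T x < ennreal (gauss_cyl x powr s)"
    then show "\<exists>y. (length y = Suc n \<and> T y < ennreal (gauss_cyl y powr s)) \<and> (\<exists>a\<in>A. n \<le> a \<and> y = x @ [a])"
      using step[of x] by (metis length_append_singleton)
  qed
  then obtain g where g: "\<And>n. length (g n) = n" "\<And>n. T (g n) < ennreal (gauss_cyl (g n) powr s)"
    "\<And>n. \<exists>a\<in>A. n \<le> a \<and> g (Suc n) = g n @ [a]" by blast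
  from g(3) obtain f where f: "\<And>n. f n \<in> A" "\<And>n. n \<le> f n" "\<And>n. g (Suc n) = g n @ [f n]" by metis
  have stem: "stem f n = g n" for n
  proof (induction n)
    case 0
    then show ?case using g(1)[of 0] by simp
  qed (simp add: f(3))
  have "filterlim f at_top sequentially"
    by (rule filterlim_at_top_mono[OF filterlim_ident]) (use f(2) in simp)
  then have "f \<in> divergent_seqs A" using f(1) by (auto simp: divergent_seqs_def)
  moreover have "f \<notin> cylinder (w i)" if "i \<in> I" for i
  proof
    assume "f \<in> cylinder (w i)"
    then have wi: "w i = g (length (w i))" using stem by (simp add: cylinder_def)
    \<comment> \<open>If the branch passed through \<open>w i\<close>, the single term
      \<open>e i\<close> would already lift \<open>T (w i)\<close> to the weight it must stay
      below.\<close>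
    have "e i = (\<Sum>j\<in>{i}. if j \<in> I \<and> prefix (w i) (w j) then e j else 0)" using that by simp
    also have "\<dots> \<le> T (w i)" unfolding T_def by (intro sum_le_suminf summableI) auto
    finally have "ennreal (gauss_cyl (w i) powr s) \<le> T (w i)" using w[OF that] by (rule order_trans[rotated])
    then show False using g(2)[of "length (w i)"] wi by simp
  qed
  ultimately show ?thesis by blast
qed

text \<open>The cylinder of the longest common prefix of \<open>U\<close> has the same diameter as
  \<open>U\<close>. A singleton has no longest prefix and diameter 0, so it needs the slack
  \<open>\<eta>\<close>. For \<open>s = 0\<close> every nonempty set has weight 1 and the whole
  space serves.\<close>

lemma cover_by_cylinder:
  assumes "U \<noteq> {}" "0 \<le> s" "0 < \<eta>"
  shows "\<exists>w. U \<subseteq> cylinder w \<and> ennreal (gauss_cyl w powr s) \<le> gauss.diam_pow s U + ennreal \<eta>"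
proof (cases "s = 0")
  case True
  have "U \<subseteq> cylinder []" by (auto simp: cylinder_def)
  moreover have "ennreal (gauss_cyl [] powr s) \<le> gauss.diam_pow s U + ennreal \<eta>"
    using True assms gauss_cyl_pos[of "[]"] by (simp add: gauss.diam_pow_def)
  ultimately show ?thesis by blast
next
  case False
  then have s: "0 < s" using assms by simp
  obtain x where x: "x \<in> U" using assms by blast
  show ?thesis
  proof (cases "U = {x}")
    case True
    obtain n where n: "gauss_cyl (stem x n) \<le> \<eta> powr (1 / s)"
      using gauss_cyl_stem_small[of "\<eta> powr (1 / s)" x] assms by auto
    then have "gauss_cyl (stem x n) powr s \<le> (\<eta> powr (1 / s)) powr s"
      using s gauss_cyl_pos[of "stem x n"] by (intro powr_mono2) auto
    also have "\<dots> = \<eta>" using s assms by (simp add: powr_powr)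
    finally have "ennreal (gauss_cyl (stem x n) powr s) \<le> ennreal \<eta>" by (rule ennreal_leI)
    then have "ennreal (gauss_cyl (stem x n) powr s) \<le> gauss.diam_pow s U + ennreal \<eta>"
      by (rule order_trans) simp
    then show ?thesis using True mem_cylinder_stem[of x n] by blast
  next
    case False
    then obtain y where "y \<in> U" "y \<noteq> x" using x by blast
    then have "\<exists>n. x n \<noteq> y n" by (metis ext)
    then have ex: "\<exists>n. \<exists>y\<in>U. x n \<noteq> y n" using \<open>y \<in> U\<close> by blast
    \<comment> \<open>The length of the longest common prefix of \<open>U\<close>; a member
      differing from \<open>x\<close> at this index realises the diameter.\<close>
    define n where "n = (LEAST n. \<exists>y\<in>U. x n \<noteq> y n)"
    have "\<exists>y\<in>U. x n \<noteq> y n" unfolding n_def by (rule LeastI_ex[OF ex])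
    then obtain z where z: "z \<in> U" "x n \<noteq> z n" by (elim bexE) (rule that)
    have agree: "x i = y i" if "y \<in> U" "i < n" for y i
      using not_less_Least[OF that(2)[unfolded n_def]] that(1) by auto
    have sub: "U \<subseteq> cylinder (stem x n)" using agree by (force simp: cylinder_stem)
    have "gauss_cyl (stem x n) \<le> gauss.mdiameter U"
    proof -
      have "gauss_cyl (stem x n) = gauss_dist x z" using gauss_dist_eqI[of n x z] agree[OF z(1)] z(2) by simp
      also have "\<dots> \<le> (SUP (x, y)\<in>U \<times> U. gauss_dist x y)"
      proof (rule cSUP_upper2[where x = "(x, z)"])
        show "bdd_above ((\<lambda>(x, y). gauss_dist x y) ` (U \<times> U))"
          by (rule bdd_aboveI[of _ "gauss_cyl []"])
             (auto intro!: gauss_dist_le_cylinder simp: cylinder_def)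
      qed (use x z in auto)
      finally show ?thesis using x by (auto simp: gauss.mdiameter_def)
    qed
    then have "gauss_cyl (stem x n) powr s \<le> gauss.mdiameter U powr s"
      using s gauss_cyl_pos[of "stem x n"] by (intro powr_mono2) auto
    then have "ennreal (gauss_cyl (stem x n) powr s) \<le> ennreal (gauss.mdiameter U powr s)"
      by (rule ennreal_leI)
    also have "\<dots> = gauss.diam_pow s U" using s assms(1) by (simp add: gauss.diam_pow_def)
    finally have "ennreal (gauss_cyl (stem x n) powr s) \<le> gauss.diam_pow s U + ennreal \<eta>"
      by (rule order_trans) simp
    then show ?thesis using sub by blast
  qed
qed

text \<open>Replacing a cover at scale 1 by cylinders costs arbitrarily little weight; were the
  total below \<open>gauss_cyl [] powr s\<close>, some sequence in the set would be missed. This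
  bounds the content at one scale, hence the supremum over all scales.\<close>

lemma hausdorff_measure_divergent_seqs:
  assumes "A \<subseteq> {0<..}" "0 \<le> s" "2 * s < zeta_dim A"
  shows "gauss.hausdorff_measure s (divergent_seqs A) \<noteq> 0"
proof -
  let ?F = "divergent_seqs A"
  have "\<not> (\<lambda>n. real n powr (- (2 * s))) summable_on A"
  proof
    assume "(\<lambda>n. real n powr (- (2 * s))) summable_on A"
    then have "zeta_dim A \<le> 2 * s"
      unfolding zeta_dim_def using assms(2) by (intro cInf_lower bdd_belowI[of _ 0]) auto
    then show False using assms(3) by simp
  qed
  have large: "\<exists>B. finite B \<and> B \<subseteq> A \<inter> {k..} \<and> 1 \<le> (\<Sum>a\<in>B. (1 / (48 * real a ^ 2)) powr s)" for k
  proof -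
    \<comment> \<open>The threshold \<open>48 powr s\<close> cancels the constant of
      \<open>gauss_cyl_snoc_ge\<close>.\<close>
    obtain B where B: "finite B" "B \<subseteq> A \<inter> {k..}" "48 powr s \<le> (\<Sum>a\<in>B. real a powr (- (2 * s)))"
      by (rule not_summable_on_tail_large[of "\<lambda>n. real n powr (- (2 * s))" A k "48 powr s"])
         (use \<open>\<not> _ summable_on A\<close> in auto)
    have "(\<Sum>a\<in>B. (1 / (48 * real a ^ 2)) powr s) = (\<Sum>a\<in>B. (1 / 48 powr s) * real a powr (- (2 * s)))"
    proof (rule sum.cong)
      fix a assume "a \<in> B"
      then have "0 < a" using B assms(1) by auto
      then show "(1 / (48 * real a ^ 2)) powr s = (1 / 48 powr s) * real a powr (- (2 * s))"
        by (simp add: powr_divide powr_mult powr_minus_divide powr_powr flip: powr_numeral)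
    qed simp
    also have "\<dots> = (1 / 48 powr s) * (\<Sum>a\<in>B. real a powr (- (2 * s)))" by (simp add: sum_distrib_left)
    also have "\<dots> \<ge> (1 / 48 powr s) * 48 powr s" using B(3) by (intro mult_left_mono) auto
    finally have "1 \<le> (\<Sum>a\<in>B. (1 / (48 * real a ^ 2)) powr s)" by simp
    then show ?thesis using B(1,2) by blast
  qed
  define c where "c = gauss_cyl [] powr s"
  have "0 < c" using gauss_cyl_pos[of "[]"] by (simp add: c_def)
  have "ennreal c \<le> (\<Sum>i. gauss.diam_pow s (U i))" if U: "gauss.delta_cover 1 ?F U" for U
  proof (rule ccontr)
    assume "\<not> ?thesis"
    then have less: "(\<Sum>i. gauss.diam_pow s (U i)) < ennreal c" by simp
    then obtain r where r: "0 \<le> r" "(\<Sum>i. gauss.diam_pow s (U i)) = ennreal r" "r < c"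
      by (cases "\<Sum>i. gauss.diam_pow s (U i)") (auto simp: ennreal_less_iff)
    \<comment> \<open>Half of the gap between the weight of the cover and \<open>c\<close>, to be
      spread over the sets as a geometric series.\<close>
    define \<eta> where "\<eta> = (c - r) / 2"
    have \<eta>: "0 < \<eta>" "r + \<eta> < c" using r(3) by (auto simp: \<eta>_def field_simps)
    define e where "e = (\<lambda>i. gauss.diam_pow s (U i) + ennreal (\<eta> * (1 / 2) ^ Suc i))"
    \<comment> \<open>Empty members are exempt: they have weight 0 and cover nothing.\<close>
    have "\<exists>w. U i \<noteq> {} \<longrightarrow> U i \<subseteq> cylinder w \<and> ennreal (gauss_cyl w powr s) \<le> e i" for i
      using cover_by_cylinder[of "U i" s "\<eta> * (1 / 2) ^ Suc i"] \<eta>(1) assms(2) unfolding e_def by auto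
    then obtain w where w: "\<And>i. U i \<noteq> {} \<Longrightarrow> U i \<subseteq> cylinder (w i)"
      "\<And>i. U i \<noteq> {} \<Longrightarrow> ennreal (gauss_cyl (w i) powr s) \<le> e i" by metis
    have "(\<Sum>i. e i) = (\<Sum>i. gauss.diam_pow s (U i)) + (\<Sum>i. ennreal (\<eta> * (1 / 2) ^ Suc i))"
      unfolding e_def by (intro suminf_add[symmetric] summableI)
    also have "(\<Sum>i. ennreal (\<eta> * (1 / 2) ^ Suc i)) = ennreal \<eta>"
      using sums_mult[OF power_half_series, of \<eta>] \<eta>(1) by (intro suminf_ennreal_eq) auto
    also have "(\<Sum>i. gauss.diam_pow s (U i)) + ennreal \<eta> < ennreal c"
      using r \<eta> by (simp add: ennreal_less_iff flip: ennreal_plus)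
    finally have e_less: "(\<Sum>i. e i) < ennreal (gauss_cyl [] powr s)" by (simp add: c_def)
    have "\<exists>f\<in>?F. \<forall>i\<in>{i. U i \<noteq> {}}. f \<notin> cylinder (w i)"
      by (rule exists_uncovered_divergent_seq[OF large assms(1,2) e_less]) (rule w(2), simp)
    then obtain f where f: "f \<in> ?F" "\<And>i. U i \<noteq> {} \<Longrightarrow> f \<notin> cylinder (w i)" by blast
    obtain i where "f \<in> U i" using f(1) U by (auto simp: gauss.delta_cover_def)
    then show False using f(2)[of i] w(1)[of i] by blast
  qed
  then have "ennreal c \<le> gauss.hausdorff_content s 1 ?F"
    unfolding gauss.hausdorff_content_def by (intro INF_greatest) simp
  also have "\<dots> \<le> gauss.hausdorff_measure s ?F"
    unfolding gauss.hausdorff_measure_eq_SUP by (rule SUP_upper) simp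
  finally show ?thesis using \<open>0 < c\<close> by auto
qed

theorem theorem4p4:
  fixes A :: "nat set"
  assumes "A \<subseteq> {0<..}"
  shows "ereal (zeta_dim A) = 2 * dim_gauss (divergent_seqs A) \<and>
         2 * dim_gauss (divergent_seqs A) = 2 * Dim_gauss (divergent_seqs A)"
proof -
  have "0 \<le> zeta_dim A"
    unfolding zeta_dim_def
    by (rule cInf_greatest[OF zeta_exponents_nonempty]) simp
  \<comment> \<open>The measure is known to vanish only strictly above half the zeta-dimension,
    hence the margin \<open>e\<close>.\<close>
  have "Dim_gauss (divergent_seqs A) \<le> ereal (zeta_dim A / 2)"
  proof (rule ereal_le_epsilon2)
    fix e :: real assume "0 < e"
    then have "gauss.packing_measure (zeta_dim A / 2 + e) (divergent_seqs A) = 0"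
      using assms by (intro packing_measure_divergent_seqs) auto
    then show "Dim_gauss (divergent_seqs A) \<le> ereal (zeta_dim A / 2) + ereal e"
      unfolding Dim_gauss_def gauss.packing_dim_def
      using \<open>0 < e\<close> \<open>0 \<le> zeta_dim A\<close> by (intro Inf_lower) auto
  qed
  moreover have "ereal (zeta_dim A / 2) \<le> dim_gauss (divergent_seqs A)"
    unfolding dim_gauss_def gauss.hausdorff_dim_def
  proof (rule Inf_greatest, clarify)
    fix s :: real assume "0 \<le> s" "gauss.hausdorff_measure s (divergent_seqs A) = 0"
    then have "\<not> 2 * s < zeta_dim A" using hausdorff_measure_divergent_seqs[OF assms] by blast
    then show "ereal (zeta_dim A / 2) \<le> ereal s" by simp
  qed
  \<comment> \<open>With \<open>dim_gauss_le_Dim_gauss\<close> the inequalities close up from half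
    the zeta-dimension back to itself.\<close>
  ultimately have "dim_gauss (divergent_seqs A) = ereal (zeta_dim A / 2)"
    "Dim_gauss (divergent_seqs A) = ereal (zeta_dim A / 2)"
    using dim_gauss_le_Dim_gauss[of "divergent_seqs A"] by (auto intro: antisym order_trans)
  then show ?thesis by simp
qed

end
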